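(* For every dimension $n\geq 1$, the diameter $D_1$ of the convex hull of standard Brownian motion in $\mathbb{R}^n$ run up to time $1$ satisfies \[ \sqrt{n}\;\leq\;\mathbb{E}\left[D_1\right]\;\leq\; 2\sqrt{\log 2}\,\sqrt{n}. \]
   Context: Let $\boldsymbol{W}=\{\boldsymbol{W}_t:t\geq 0\}$ be standard Brownian motion in $\mathbb{R}^n$ started at the origin, i.e. $\boldsymbol{W}_t=(W_t^{(1)},\dots,W_t^{(n)})$ where the coordinates are independent standard one-dimensional Brownian motions. Let $\mathcal{H}_t:=\operatorname{conv}\{\boldsymbol{W}_s:0\leq s\leq t\}$ be the convex hull of the path up to time $t$ (almost surely a nonempty compact convex set). Let $D_t:=D(\mathcal{H}_t)$, where $D(\mathcal{K})$ denotes the Euclidean diameter of $\mathcal{K}$. $\log$ is the natural logarithm. *)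

theory Defs
  imports "HOL-Probability.Probability"
begin

(* Time is indexed by all of real, but only times t >= 0 are constrained or used. *)
locale std_brownian_motion = prob_space M
  for M :: "'a measure" and B :: "real \<Rightarrow> 'a \<Rightarrow> real" +
  assumes random_variable_at: "\<And>t. 0 \<le> t \<Longrightarrow> random_variable borel (B t)"
    and starts_at_0: "AE \<omega> in M. B 0 \<omega> = 0"
    and independent_increments:
      "\<And>(t :: nat \<Rightarrow> real) k. 0 \<le> t 0 \<Longrightarrow> (\<And>i. i < k \<Longrightarrow> t i \<le> t (Suc i)) \<Longrightarrow>
         indep_vars (\<lambda>_. borel) (\<lambda>i \<omega>. B (t (Suc i)) \<omega> - B (t i) \<omega>) {..<k}"
    and normal_increments:
      "\<And>s t. 0 \<le> s \<Longrightarrow> s < t \<Longrightarrow>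
         distributed M lborel (\<lambda>\<omega>. B t \<omega> - B s \<omega>) (normal_density 0 (sqrt (t - s)))"
    and continuous_paths: "AE \<omega> in M. continuous_on {0..} (\<lambda>t. B t \<omega>)"

(* Independence is that of the whole coordinate processes, seen as random elements of the
   product measurable space indexed by the time set {0..}. *)
locale std_brownian_motion_vec = prob_space M
  for M :: "'a measure" and W :: "real \<Rightarrow> 'a \<Rightarrow> real ^ 'n" +
  assumes coordinates: "\<And>i. std_brownian_motion M (\<lambda>t \<omega>. W t \<omega> $ i)"
    and independent_coordinates:
      "indep_vars (\<lambda>_. Pi\<^sub>M {0..} (\<lambda>_. borel)) (\<lambda>i \<omega>. \<lambda>t\<in>{0..}. W t \<omega> $ i) UNIV"

definition path_hull :: "(real \<Rightarrow> 'a \<Rightarrow> real ^ 'n) \<Rightarrow> real \<Rightarrow> 'a \<Rightarrow> (real ^ 'n) set" where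
  "path_hull W t \<omega> = convex hull ((\<lambda>s. W s \<omega>) ` {0..t})"

definition hull_diameter :: "(real \<Rightarrow> 'a \<Rightarrow> real ^ 'n) \<Rightarrow> real \<Rightarrow> 'a \<Rightarrow> real" where
  "hull_diameter W t \<omega> = diameter (path_hull W t \<omega>)"

(* Expectation with respect to the completed probability measure. Paths are continuous only
   almost surely, so on an exceptional null set a path functional such as the diameter may fail
   to be M-measurable; completing M makes the values there irrelevant. On M-measurable
   functions this is the usual expectation. *)
definition completed_expectation :: "'a measure \<Rightarrow> ('a \<Rightarrow> real) \<Rightarrow> real" where
  "completed_expectation M X = integral\<^sup>L (completion M) X"

end

theory Submission
  imports Defs "HOL-Real_Asymp.Real_Asymp"
begin

text \<open>
The distances between points of the hull are controlled by distances between points of the path, so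
the diameter is at least the largest displacement from the starting point, and its square is at most
the sum over the coordinates of the squared ranges (maximum minus minimum). Both bounds are computed for the
Gaussian walks that Brownian motion induces on equidistant time grids. The grid diameters converge to
the diameter by continuity of paths (\<open>grid_diameter_tendsto\<close>), and scale invariance relates grids of
different mesh (\<open>mean_sq_range_scaling\<close>, \<open>mean_max_scaling\<close>).

Upper bound. It suffices that the squared range of one-dimensional Brownian motion at time \<open>1\<close> has mean at
most \<open>4 * ln 2\<close>, which is the true value. With position \<open>x\<close>, running maximum \<open>a\<close> and running minimum \<open>b\<close>,
both \<open>cosh (2 * (a - x))\<close> and \<open>cosh (2 * (x - b))\<close> become martingales after discounting by \<open>exp (- 2 * t)\<close>.
Multiplying their sum by a suitable decreasing function of the range \<open>a - b\<close> gives a function whose discounted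
decrease pays for every increase of the squared range (\<open>lyapunov_update\<close>). Its initial value is \<open>ln 2\<close>.
Hence the discounted total growth of the squared range is bounded
(\<open>normal_walk_discounted_range\<close>), and since the mean squared range is linear in time this determines its
slope (\<open>mean_sq_range_le\<close>).

Lower bound. Let \<open>S t\<close> be the largest displacement up to time \<open>t\<close> and let \<open>m\<close> be such that \<open>S t\<close> has mean at most
\<open>m * sqrt t\<close>. The squared displacement has drift \<open>n\<close>. Integrating \<open>1 / S\<close> against it gives in the mean
\<open>n\<close> times the integral of the mean of \<open>1 / S\<close>, which by convexity is at least \<open>2 * n * sqrt t / m\<close>. On the other hand
integration by parts shows that the integral is at most \<open>2 * S t\<close>, of mean at most \<open>2 * m * sqrt t\<close>. So
\<open>n \<le> m\<^sup>2\<close> (\<open>mean_max_growth\<close>). For a walk the running maximum may overshoot, and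
\<open>floored_max_sum\<close> controls the resulting error.
\<close>

section \<open>A Lyapunov function for the range\<close>

text \<open>
For \<open>r \<ge> 0\<close> this is the decreasing function with derivative \<open>- r / (cosh r)\<^sup>2\<close> that vanishes at infinity, so
it equals the integral of \<open>u / (cosh u)\<^sup>2\<close> over \<open>u \<ge> r\<close>. Its value \<open>ln 2\<close> at \<open>0\<close> is the
source of the constant in the upper bound.
\<close>

definition potential :: "real \<Rightarrow> real" where
  "potential r = ln 2 + ln (cosh r) - r * tanh r"

lemma potential_0 [simp]: "potential 0 = ln 2"
  by (simp add: potential_def)

lemma potential_measurable [measurable]: "potential \<in> borel_measurable borel"
proof -
  have "continuous_on UNIV potential"
    unfolding potential_def[abs_def]
    by (intro continuous_intros) (auto simp: cosh_real_nonzero)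
  then show ?thesis by (rule borel_measurable_continuous_onI)
qed

lemma potential_has_derivative:
  "(potential has_real_derivative - r / (cosh r)\<^sup>2) (at r)"
proof -
  have "(potential has_real_derivative sinh r / cosh r - (tanh r + r * (1 - (tanh r)\<^sup>2))) (at r)"
    unfolding potential_def[abs_def]
    by (auto intro!: derivative_eq_intros simp: cosh_real_nonzero field_simps)
  moreover have "1 - (tanh r)\<^sup>2 = 1 / (cosh r)\<^sup>2"
  proof -
    have "(tanh r)\<^sup>2 = ((cosh r)\<^sup>2 - 1) / (cosh r)\<^sup>2"
      by (simp add: tanh_def power_divide cosh_square_eq)
    then show ?thesis using cosh_real_nonzero[of r] by (simp add: diff_divide_distrib)
  qed
  ultimately show ?thesis by (simp add: tanh_def)
qed

text \<open>
This form displays the exponential decay, which makes the Lyapunov function below integrable.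
\<close>

lemma potential_alt: "potential r = ln (1 + exp (-2 * r)) + 2 * r / (exp (2 * r) + 1)"
proof -
  have "cosh r = exp r * (1 + exp (-2 * r)) / 2"
    by (simp add: cosh_def distrib_left flip: exp_add)
  moreover have "0 < 1 + exp (- 2 * r)" by (intro add_pos_pos) auto
  then have "ln (exp r * (1 + exp (-2 * r)) / 2) = r + ln (1 + exp (-2 * r)) - ln 2"
    by (simp add: ln_mult ln_div)
  ultimately have "ln (cosh r) = r + ln (1 + exp (-2 * r)) - ln 2"
    by (simp only:)
  moreover have "r - r * tanh r = 2 * r / (exp (2 * r) + 1)"
  proof -
    have "tanh r = (exp (2 * r) - 1) / (exp (2 * r) + 1)"
    proof -
      have "(1 - 1 / e) / (1 + 1 / e) = (e - 1) / (e + 1)" if "0 < e" for e :: real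
        using that by (auto simp: divide_simps)
      from this[of "exp (2 * r)"] show ?thesis
        by (simp add: tanh_real_altdef exp_minus inverse_eq_divide)
    qed
    moreover have "r - r * ((e - 1) / (e + 1)) = 2 * r / (e + 1)" if "0 < e" for e :: real
      using that by (simp add: field_simps)
    ultimately show ?thesis by simp
  qed
  ultimately show ?thesis unfolding potential_def by simp
qed

lemma potential_nonneg: "0 \<le> r \<Longrightarrow> 0 \<le> potential r"
  unfolding potential_alt by (intro add_nonneg_nonneg) (auto intro!: divide_nonneg_pos add_pos_pos)

lemma potential_le:
  assumes "0 \<le> r" shows "potential r \<le> (1 + 2 * r) * exp (-2 * r)"
proof -
  have "ln (1 + exp (-2 * r)) \<le> exp (-2 * r)" by (rule ln_add_one_self_le_self) simp
  moreover have "2 * r / (exp (2 * r) + 1) \<le> 2 * r / exp (2 * r)"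
    using assms by (intro divide_left_mono) (auto intro!: mult_pos_pos add_pos_pos)
  ultimately show ?thesis
    unfolding potential_alt by (simp add: exp_minus field_simps)
qed

text \<open>
Here \<open>x\<close> is the current position of a path and \<open>a\<close>, \<open>b\<close> are its maximum and minimum so far. As long as
\<open>a\<close> and \<open>b\<close> do not move, a centred normal step of variance \<open>\<sigma>\<^sup>2\<close> multiplies the mean of either
hyperbolic cosine by \<open>exp (2 * \<sigma>\<^sup>2)\<close>. The factor \<open>potential (a - b)\<close> is chosen so that a growth of the
range is paid for by a decrease of the function.
\<close>

definition lyapunov :: "real \<Rightarrow> real \<Rightarrow> real \<Rightarrow> real" where
  "lyapunov x a b = potential (a - b) * (cosh (2 * (a - x)) + cosh (2 * (x - b))) / 2"

text \<open>
Raise the maximum continuously from \<open>a\<close> to \<open>x\<close>. The derivative of the potential contributes at most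
\<open>- (s - b)\<close>, because \<open>cosh (2 * (x - b)) + 1 = 2 * (cosh (x - b))\<^sup>2\<close> dominates
\<open>2 * (cosh (s - b))\<^sup>2\<close>, and the derivative of \<open>cosh (2 * (s - x))\<close> has a favourable sign. A jump
beyond the old maximum therefore costs nothing, and the discrete walk satisfies the same inequality as
Brownian motion, without an error term.
\<close>

lemma lyapunov_new_maximum:
  assumes "b \<le> a" "a \<le> x"
  shows "lyapunov x x b + ((x - b)\<^sup>2 - (a - b)\<^sup>2) / 2 \<le> lyapunov x a b"
proof -
  let ?f = "\<lambda>s. lyapunov x s b + (s - b)\<^sup>2 / 2"
  have "\<exists>y. (?f has_real_derivative y) (at s) \<and> y \<le> 0" if s: "a \<le> s" "s \<le> x" for s
  proof -
    have "(?f has_real_derivative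
        (- (s - b) / (cosh (s - b))\<^sup>2) * (cosh (2 * (s - x)) + cosh (2 * (x - b))) / 2
        + potential (s - b) * sinh (2 * (s - x)) + (s - b)) (at s)"
      unfolding lyapunov_def
      by (auto intro!: derivative_eq_intros DERIV_chain2[OF potential_has_derivative]
          simp: field_simps)
    moreover have "(- (s - b) / (cosh (s - b))\<^sup>2) * (cosh (2 * (s - x)) + cosh (2 * (x - b))) / 2
        \<le> - (s - b)"
    proof -
      have "cosh (2 * (x - b)) = 2 * (cosh (x - b))\<^sup>2 - 1"
        using cosh_double_cosh by blast
      moreover have "1 \<le> cosh (2 * (s - x))" by (rule cosh_real_ge_1)
      ultimately have "2 * (cosh (x - b))\<^sup>2 \<le> cosh (2 * (s - x)) + cosh (2 * (x - b))"
        by simp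
      moreover have "cosh (s - b) \<le> cosh (x - b)"
        using s assms by (subst cosh_real_nonneg_le_iff) auto
      then have "2 * (cosh (s - b))\<^sup>2 \<le> 2 * (cosh (x - b))\<^sup>2"
        by (intro mult_left_mono power_mono) auto
      ultimately have "2 * (cosh (s - b))\<^sup>2 \<le> cosh (2 * (s - x)) + cosh (2 * (x - b))"
        by (rule order.trans[rotated])
      then have "1 \<le> (cosh (2 * (s - x)) + cosh (2 * (x - b))) / 2 / (cosh (s - b))\<^sup>2"
        by (simp add: le_divide_eq)
      then have "(s - b) * 1 \<le> (s - b) * ((cosh (2 * (s - x)) + cosh (2 * (x - b))) / 2 / (cosh (s - b))\<^sup>2)"
        using s assms by (intro mult_left_mono) auto
      moreover have "(- p / q) * v / 2 = - (p * (v / 2 / q))" for p q v :: real by simp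
      ultimately show ?thesis by (simp only: neg_le_iff_le mult_1_right)
    qed
    moreover have "potential (s - b) * sinh (2 * (s - x)) \<le> 0"
      using s assms potential_nonneg[of "s - b"] by (auto intro!: mult_nonneg_nonpos)
    moreover have "p + q + v \<le> 0" if "p \<le> - v" "q \<le> 0" for p q v :: real
      using that by simp
    ultimately show ?thesis by blast
  qed
  from DERIV_nonpos_imp_nonincreasing[OF assms(2) this]
  show ?thesis by (simp add: field_simps)
qed

lemma lyapunov_uminus: "lyapunov (- x) (- b) (- a) = lyapunov x a b"
  unfolding lyapunov_def by (simp add: add.commute)

text \<open>
A new minimum is a new maximum of the reflected path.
\<close>

lemma lyapunov_update:
  assumes "b \<le> a"
  shows "lyapunov x (max a x) (min b x) + ((max a x - min b x)\<^sup>2 - (a - b)\<^sup>2) / 2 \<le> lyapunov x a b"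
proof -
  consider "a \<le> x" | "x \<le> b" | "b \<le> x" "x \<le> a" by linarith
  then show ?thesis
  proof cases
    case 1
    with assms lyapunov_new_maximum[of b a x] show ?thesis by (simp add: max_def min_def)
  next
    case 2
    have "lyapunov (- x) (- x) (- a) + ((- x - - a)\<^sup>2 - (- b - - a)\<^sup>2) / 2 \<le> lyapunov (- x) (- b) (- a)"
      using assms 2 by (intro lyapunov_new_maximum) auto
    moreover have "max a x = a" "min b x = x" "- x - - a = a - x" "- b - - a = a - b"
      using assms 2 by auto
    ultimately show ?thesis by (simp only: lyapunov_uminus)
  next
    case 3
    then show ?thesis by (simp add: max_def min_def)
  qed
qed

text \<open>
The two parts of the Lyapunov function that a step \<open>u\<close> multiplies by \<open>exp (2 * u)\<close> and by
\<open>exp (- 2 * u)\<close>.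
\<close>

definition lyapunov_up :: "real \<Rightarrow> real \<Rightarrow> real \<Rightarrow> real" where
  "lyapunov_up x a b = potential (a - b) * (exp (- 2 * (a - x)) + exp (2 * (x - b))) / 4"

definition lyapunov_down :: "real \<Rightarrow> real \<Rightarrow> real \<Rightarrow> real" where
  "lyapunov_down x a b = potential (a - b) * (exp (2 * (a - x)) + exp (- 2 * (x - b))) / 4"

lemma lyapunov_shift:
  "lyapunov (x + u) a b = lyapunov_up x a b * exp (2 * u) + lyapunov_down x a b * exp (- 2 * u)"
  unfolding lyapunov_def lyapunov_up_def lyapunov_down_def cosh_def
  by (simp add: algebra_simps add_divide_distrib diff_divide_distrib flip: exp_add)

lemma lyapunov_parts_bounds:
  assumes "b \<le> x" "x \<le> a"
  shows "0 \<le> lyapunov_up x a b" "0 \<le> lyapunov_down x a b"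
    "lyapunov_up x a b \<le> 1 + 2 * (a - b)" "lyapunov_down x a b \<le> 1 + 2 * (a - b)"
proof -
  have p: "0 \<le> potential (a - b)" using assms by (intro potential_nonneg) auto
  show "0 \<le> lyapunov_up x a b" "0 \<le> lyapunov_down x a b"
    unfolding lyapunov_up_def lyapunov_down_def using p by auto
  have *: "potential (a - b) * (u + v) / 4 \<le> 1 + 2 * (a - b)"
    if "u \<le> exp (2 * (a - b))" "v \<le> exp (2 * (a - b))" for u v
  proof -
    have "potential (a - b) * (u + v) \<le> potential (a - b) * (4 * exp (2 * (a - b)))"
      using that p by (intro mult_left_mono) (auto intro: order.trans[of _ "2 * exp (2 * (a - b))"])
    also have "\<dots> \<le> ((1 + 2 * (a - b)) * exp (- 2 * (a - b))) * (4 * exp (2 * (a - b)))"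
      using assms by (intro mult_right_mono potential_le) auto
    also have "\<dots> = 4 * (1 + 2 * (a - b)) * (exp (- 2 * (a - b)) * exp (2 * (a - b)))"
      by (simp add: ac_simps)
    also have "\<dots> = 4 * (1 + 2 * (a - b))"
      by (simp flip: exp_add)
    finally show ?thesis by simp
  qed
  show "lyapunov_up x a b \<le> 1 + 2 * (a - b)" "lyapunov_down x a b \<le> 1 + 2 * (a - b)"
    unfolding lyapunov_up_def lyapunov_down_def using assms by (intro *; simp)+
qed

lemma lyapunov_nonneg:
  assumes "b \<le> x" "x \<le> a" shows "0 \<le> lyapunov x a b"
  using lyapunov_shift[of x 0 a b] lyapunov_parts_bounds[OF assms] by simp

section \<open>Running extrema of a sequence\<close>

definition run_max :: "(nat \<Rightarrow> real) \<Rightarrow> nat \<Rightarrow> real" where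
  "run_max x k = Max (x ` {..k})"

definition run_min :: "(nat \<Rightarrow> real) \<Rightarrow> nat \<Rightarrow> real" where
  "run_min x k = Min (x ` {..k})"

definition run_range :: "(nat \<Rightarrow> real) \<Rightarrow> nat \<Rightarrow> real" where
  "run_range x k = run_max x k - run_min x k"

lemma run_0 [simp]: "run_max x 0 = x 0" "run_min x 0 = x 0" "run_range x 0 = 0"
  by (simp_all add: run_max_def run_min_def run_range_def)

lemma run_max_Suc: "run_max x (Suc k) = max (run_max x k) (x (Suc k))"
  by (simp add: run_max_def atMost_Suc max.commute)

lemma run_min_Suc: "run_min x (Suc k) = min (run_min x k) (x (Suc k))"
  by (simp add: run_min_def atMost_Suc min.commute)

lemma run_cong:
  assumes "\<And>j. j \<le> k \<Longrightarrow> x j = y j"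
  shows "run_max x k = run_max y k" "run_min x k = run_min y k" "run_range x k = run_range y k"
  using assms by (auto simp: run_max_def run_min_def run_range_def cong: image_cong_simp)

lemma run_bounds: "j \<le> k \<Longrightarrow> run_min x k \<le> x j" "j \<le> k \<Longrightarrow> x j \<le> run_max x k"
  by (auto simp: run_max_def run_min_def)

lemma run_max_le_iff: "run_max x k \<le> c \<longleftrightarrow> (\<forall>j\<le>k. x j \<le> c)"
  by (auto simp: run_max_def)

lemma run_min_le_max: "run_min x k \<le> run_max x k"
  using run_bounds[of 0 k x] by simp

lemma run_range_nonneg: "0 \<le> run_range x k"
  using run_min_le_max[of x k] by (simp add: run_range_def)

lemma dist_le_run_range: "i \<le> k \<Longrightarrow> j \<le> k \<Longrightarrow> \<bar>x i - x j\<bar> \<le> run_range x k"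
  using run_bounds[of i k x] run_bounds[of j k x] by (auto simp: run_range_def)

lemma run_range_le:
  assumes "\<And>i j. i \<le> k \<Longrightarrow> j \<le> k \<Longrightarrow> \<bar>x i - x j\<bar> \<le> c" shows "run_range x k \<le> c"
proof -
  have "run_max x k \<in> x ` {..k}" "run_min x k \<in> x ` {..k}"
    unfolding run_max_def run_min_def by (intro Max_in Min_in; simp)+
  then obtain i j where "run_max x k = x i" "run_min x k = x j" "i \<le> k" "j \<le> k" by auto
  with assms[of i j] show ?thesis by (simp add: run_range_def)
qed

lemma run_max_cmult: "0 \<le> c \<Longrightarrow> run_max (\<lambda>j. c * x j) k = c * run_max x k"
  by (induction k) (auto simp: run_max_Suc max_mult_distrib_left)

lemma run_range_affine:
  assumes "0 \<le> c" shows "run_range (\<lambda>j. c * x j + d) k = c * run_range x k"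
proof -
  have "run_max (\<lambda>j. c * x j + d) k = c * run_max x k + d" using assms
    by (induction k) (auto simp: run_max_Suc max_mult_distrib_left max_add_distrib_left)
  moreover have "run_min (\<lambda>j. c * x j + d) k = c * run_min x k + d" using assms
    by (induction k) (auto simp: run_min_Suc min_mult_distrib_left min_add_distrib_left)
  ultimately show ?thesis by (simp add: run_range_def algebra_simps)
qed

lemma run_range_subsequence: 
  assumes "\<And>j. j \<le> k \<Longrightarrow> f j \<le> l" shows "run_range (\<lambda>j. x (f j)) k \<le> run_range x l"
  using assms by (intro run_range_le dist_le_run_range)

lemma run_range_Suc_le: "run_range x (Suc k) \<le> run_range x k + \<bar>x (Suc k) - x k\<bar>"
  using run_bounds[of k k x] by (auto simp: run_range_def run_max_Suc run_min_Suc)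

lemma run_max_measurable [measurable (raw)]:
  assumes "\<And>j. j \<le> k \<Longrightarrow> (\<lambda>\<omega>. x j \<omega>) \<in> borel_measurable M"
  shows "(\<lambda>\<omega>. run_max (\<lambda>j. x j \<omega>) k) \<in> borel_measurable M"
  using assms by (induction k) (auto simp: run_max_Suc)

lemma run_min_measurable [measurable (raw)]:
  assumes "\<And>j. j \<le> k \<Longrightarrow> (\<lambda>\<omega>. x j \<omega>) \<in> borel_measurable M"
  shows "(\<lambda>\<omega>. run_min (\<lambda>j. x j \<omega>) k) \<in> borel_measurable M"
  using assms by (induction k) (auto simp: run_min_Suc)

lemma run_range_measurable [measurable (raw)]:
  assumes "\<And>j. j \<le> k \<Longrightarrow> (\<lambda>\<omega>. x j \<omega>) \<in> borel_measurable M"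
  shows "(\<lambda>\<omega>. run_range (\<lambda>j. x j \<omega>) k) \<in> borel_measurable M"
  unfolding run_range_def using assms by measurable

section \<open>Independent centred normal variables\<close>

context prob_space
begin

definition iid_normal :: "real \<Rightarrow> 'i set \<Rightarrow> ('i \<Rightarrow> 'a \<Rightarrow> real) \<Rightarrow> bool" where
  "iid_normal \<sigma> I Z \<longleftrightarrow> 0 < \<sigma> \<and> indep_vars (\<lambda>_. borel) Z I \<and>
     (\<forall>i\<in>I. distributed M lborel (Z i) (normal_density 0 \<sigma>))"

lemma iid_normal_mono: "iid_normal \<sigma> I Z \<Longrightarrow> J \<subseteq> I \<Longrightarrow> iid_normal \<sigma> J Z"
  unfolding iid_normal_def using indep_vars_subset by blast

lemma iid_normal_measurable: "iid_normal \<sigma> I Z \<Longrightarrow> i \<in> I \<Longrightarrow> Z i \<in> borel_measurable M"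
  unfolding iid_normal_def indep_vars_def by auto

lemma iid_normal_scale:
  assumes "iid_normal \<sigma> I Z" "0 < c"
  shows "iid_normal (c * \<sigma>) I (\<lambda>i \<omega>. c * Z i \<omega>)"
  unfolding iid_normal_def
proof (intro conjI ballI)
  show "indep_vars (\<lambda>_. borel) (\<lambda>i \<omega>. c * Z i \<omega>) I"
    using assms unfolding iid_normal_def
    by (intro indep_vars_compose2[where Y="\<lambda>_ x. c * x"]) auto
  fix i assume "i \<in> I"
  with assms have "distributed M lborel (\<lambda>\<omega>. 0 + c * Z i \<omega>) (normal_density (0 + c * 0) (\<bar>c\<bar> * \<sigma>))"
    unfolding iid_normal_def by (intro normal_density_affine) auto
  with assms show "distributed M lborel (\<lambda>\<omega>. c * Z i \<omega>) (normal_density 0 (c * \<sigma>))" by simp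
qed (use assms in \<open>auto simp: iid_normal_def\<close>)

lemma iid_normal_distr:
  assumes "iid_normal \<sigma> I Z" "I \<noteq> {}"
  shows "distr M (\<Pi>\<^sub>M i\<in>I. borel) (\<lambda>\<omega>. \<lambda>i\<in>I. Z i \<omega>) = (\<Pi>\<^sub>M i\<in>I. density lborel (normal_density 0 \<sigma>))"
proof -
  from assms have "distr M (\<Pi>\<^sub>M i\<in>I. borel) (\<lambda>\<omega>. \<lambda>i\<in>I. Z i \<omega>) = (\<Pi>\<^sub>M i\<in>I. distr M borel (Z i))"
    using assms(2) iid_normal_measurable[OF assms(1)]
    by (subst indep_vars_iff_distr_eq_PiM'[symmetric]) (auto simp: iid_normal_def)
  also have "\<dots> = (\<Pi>\<^sub>M i\<in>I. density lborel (normal_density 0 \<sigma>))"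
    using assms by (intro PiM_cong)
      (auto simp: iid_normal_def distributed_def cong: distr_cong)
  finally show ?thesis .
qed

text \<open>
Scale invariance of Brownian motion is used only through this lemma: expectations of functionals of
an independent normal family depend on the variance alone.
\<close>

lemma iid_normal_transfer:
  fixes f :: "('i \<Rightarrow> real) \<Rightarrow> real"
  assumes Z: "iid_normal \<sigma> I Z" and Z': "iid_normal \<sigma> I Z'"
    and f [measurable]: "f \<in> borel_measurable (\<Pi>\<^sub>M i\<in>I. borel)"
  shows "expectation (\<lambda>\<omega>. f (\<lambda>i\<in>I. Z i \<omega>)) = expectation (\<lambda>\<omega>. f (\<lambda>i\<in>I. Z' i \<omega>))"
proof (cases "I = {}")
  case True
  then show ?thesis by (simp add: restrict_def)
next
  case False
  have [measurable]: "(\<lambda>\<omega>. \<lambda>i\<in>I. Z i \<omega>) \<in> measurable M (\<Pi>\<^sub>M i\<in>I. borel)"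
    "(\<lambda>\<omega>. \<lambda>i\<in>I. Z' i \<omega>) \<in> measurable M (\<Pi>\<^sub>M i\<in>I. borel)"
    using iid_normal_measurable[OF Z] iid_normal_measurable[OF Z'] by (auto intro!: measurable_restrict)
  have "expectation (\<lambda>\<omega>. f (\<lambda>i\<in>I. Z i \<omega>)) = integral\<^sup>L (distr M (\<Pi>\<^sub>M i\<in>I. borel) (\<lambda>\<omega>. \<lambda>i\<in>I. Z i \<omega>)) f"
    by (rule integral_distr[symmetric]) measurable
  also have "\<dots> = integral\<^sup>L (distr M (\<Pi>\<^sub>M i\<in>I. borel) (\<lambda>\<omega>. \<lambda>i\<in>I. Z' i \<omega>)) f"
    by (simp only: iid_normal_distr[OF Z False] iid_normal_distr[OF Z' False])
  also have "\<dots> = expectation (\<lambda>\<omega>. f (\<lambda>i\<in>I. Z' i \<omega>))"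
    by (rule integral_distr) measurable
  finally show ?thesis .
qed

text \<open>
The substitute for conditioning on the past: a functional of the variables in \<open>K\<close> is independent of a
further variable \<open>Z p\<close>.
\<close>

lemma iid_normal_past_times_present:
  fixes f :: "('i \<Rightarrow> real) \<Rightarrow> real" and g :: "real \<Rightarrow> real"
  assumes Z: "iid_normal \<sigma> I Z" and K: "K \<subseteq> I" "p \<in> I" "p \<notin> K"
    and f: "f \<in> borel_measurable (\<Pi>\<^sub>M i\<in>K. borel)" and g: "g \<in> borel_measurable borel"
    and int: "integrable M (\<lambda>\<omega>. f (\<lambda>i\<in>K. Z i \<omega>))" "integrable M (\<lambda>\<omega>. g (Z p \<omega>))"
  shows "integrable M (\<lambda>\<omega>. f (\<lambda>i\<in>K. Z i \<omega>) * g (Z p \<omega>))"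
    and "expectation (\<lambda>\<omega>. f (\<lambda>i\<in>K. Z i \<omega>) * g (Z p \<omega>))
       = expectation (\<lambda>\<omega>. f (\<lambda>i\<in>K. Z i \<omega>)) * expectation (\<lambda>\<omega>. g (Z p \<omega>))"
proof -
  have "indep_var (PiM K (\<lambda>_. borel)) (\<lambda>\<omega>. restrict (\<lambda>i. Z i \<omega>) K)
      (PiM {p} (\<lambda>_. borel)) (\<lambda>\<omega>. restrict (\<lambda>i. Z i \<omega>) {p})"
    using Z K by (intro indep_var_restrict[where I=I]) (auto simp: iid_normal_def)
  then have "indep_var borel (f \<circ> (\<lambda>\<omega>. restrict (\<lambda>i. Z i \<omega>) K))
      borel ((\<lambda>x. g (x p)) \<circ> (\<lambda>\<omega>. restrict (\<lambda>i. Z i \<omega>) {p}))"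
    using f g by (intro indep_var_compose) (auto intro: measurable_compose)
  then have ind: "indep_var borel (\<lambda>\<omega>. f (\<lambda>i\<in>K. Z i \<omega>)) borel (\<lambda>\<omega>. g (Z p \<omega>))"
    by (simp add: comp_def)
  show "integrable M (\<lambda>\<omega>. f (\<lambda>i\<in>K. Z i \<omega>) * g (Z p \<omega>))"
    using int by (intro indep_var_integrable ind) auto
  show "expectation (\<lambda>\<omega>. f (\<lambda>i\<in>K. Z i \<omega>) * g (Z p \<omega>))
       = expectation (\<lambda>\<omega>. f (\<lambda>i\<in>K. Z i \<omega>)) * expectation (\<lambda>\<omega>. g (Z p \<omega>))"
    using int by (intro indep_var_lebesgue_integral ind) auto
qed

text \<open>
Multiplying the density by \<open>exp (c * x)\<close> only shifts its mean, up to the normalising factor.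
\<close>

lemma normal_exp_moment:
  assumes "distributed M lborel X (normal_density 0 \<sigma>)" "0 < \<sigma>"
  shows "integrable M (\<lambda>\<omega>. exp (c * X \<omega>))" "expectation (\<lambda>\<omega>. exp (c * X \<omega>)) = exp (c\<^sup>2 * \<sigma>\<^sup>2 / 2)"
proof -
  have eq: "normal_density 0 \<sigma> x * exp (c * x) = exp (c\<^sup>2 * \<sigma>\<^sup>2 / 2) * normal_density (c * \<sigma>\<^sup>2) \<sigma> x" for x
  proof -
    have "- x\<^sup>2 / (2 * \<sigma>\<^sup>2) + c * x = c\<^sup>2 * \<sigma>\<^sup>2 / 2 + - (x - c * \<sigma>\<^sup>2)\<^sup>2 / (2 * \<sigma>\<^sup>2)"
      using assms(2) by (simp add: field_simps power2_eq_square)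
    then have "exp (- x\<^sup>2 / (2 * \<sigma>\<^sup>2)) * exp (c * x)
        = exp (c\<^sup>2 * \<sigma>\<^sup>2 / 2) * exp (- (x - c * \<sigma>\<^sup>2)\<^sup>2 / (2 * \<sigma>\<^sup>2))"
      by (simp only: exp_add[symmetric])
    then show ?thesis by (simp add: normal_density_def)
  qed
  have "integrable lborel (\<lambda>x. normal_density 0 \<sigma> x * exp (c * x))"
    unfolding eq using assms(2) by (intro integrable_mult_right) auto
  then show "integrable M (\<lambda>\<omega>. exp (c * X \<omega>))"
    using assms by (subst distributed_integrable[OF assms(1), symmetric]) auto
  have "expectation (\<lambda>\<omega>. exp (c * X \<omega>)) = (\<integral>x. normal_density 0 \<sigma> x * exp (c * x) \<partial>lborel)"
    using assms by (subst distributed_integral[OF assms(1), symmetric]) auto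
  also have "\<dots> = exp (c\<^sup>2 * \<sigma>\<^sup>2 / 2)"
    unfolding eq using assms(2) by simp
  finally show "expectation (\<lambda>\<omega>. exp (c * X \<omega>)) = exp (c\<^sup>2 * \<sigma>\<^sup>2 / 2)" .
qed

lemma normal_power_integrable:
  assumes "distributed M lborel X (normal_density 0 \<sigma>)" "0 < \<sigma>"
  shows "integrable M (\<lambda>\<omega>. X \<omega> ^ k)"
  using integrable_normal_moment[OF assms(2), of 0 k] assms
  by (subst distributed_integrable[OF assms(1), symmetric]) auto

lemma normal_second_moment:
  assumes "distributed M lborel X (normal_density 0 \<sigma>)" "0 < \<sigma>"
  shows "expectation (\<lambda>\<omega>. (X \<omega>)\<^sup>2) = \<sigma>\<^sup>2"
  using normal_distributed_variance[OF assms(2,1)] normal_distributed_expectation[OF assms(2,1)] by simp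

end

section \<open>The range of a normal random walk\<close>

lemma lyapunov_measurable [measurable (raw)]:
  assumes [measurable]: "f \<in> borel_measurable M" "g \<in> borel_measurable M" "h \<in> borel_measurable M"
  shows "(\<lambda>\<omega>. lyapunov (f \<omega>) (g \<omega>) (h \<omega>)) \<in> borel_measurable M"
    "(\<lambda>\<omega>. lyapunov_up (f \<omega>) (g \<omega>) (h \<omega>)) \<in> borel_measurable M"
    "(\<lambda>\<omega>. lyapunov_down (f \<omega>) (g \<omega>) (h \<omega>)) \<in> borel_measurable M"
  unfolding lyapunov_def lyapunov_up_def lyapunov_down_def cosh_def by measurable

definition walk :: "(nat \<Rightarrow> real) \<Rightarrow> nat \<Rightarrow> real" where
  "walk z k = (\<Sum>l<k. z l)"

lemma walk_0 [simp]: "walk z 0 = 0" and walk_Suc: "walk z (Suc k) = walk z k + z k"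
  by (simp_all add: walk_def)

lemma walk_restrict: "j \<le> k \<Longrightarrow> walk (\<lambda>i\<in>{..<k}. z i) j = walk z j"
  by (auto simp: walk_def intro!: sum.cong)

lemma walk_measurable [measurable (raw)]:
  assumes "\<And>l. l < k \<Longrightarrow> (\<lambda>\<omega>. z l \<omega>) \<in> borel_measurable M"
  shows "(\<lambda>\<omega>. walk (\<lambda>l. z l \<omega>) k) \<in> borel_measurable M"
  unfolding walk_def using assms by measurable

lemma walk_component_measurable:
  assumes "j \<le> k" shows "(\<lambda>z. walk z j) \<in> borel_measurable (\<Pi>\<^sub>M i\<in>{..<k}. borel)"
  using assms by (intro walk_measurable) simp

context prob_space
begin

lemma normal_walk_range_sq_integrable:
  assumes Z: "iid_normal \<sigma> {..<k} Z"
  shows "integrable M (\<lambda>\<omega>. (run_range (walk (\<lambda>l. Z l \<omega>)) k)\<^sup>2)"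
  using assms
proof (induction k)
  case 0
  then show ?case by simp
next
  case (Suc k)
  note m = iid_normal_measurable[OF Suc.prems]
  have "integrable M (\<lambda>\<omega>. (run_range (walk (\<lambda>l. Z l \<omega>)) k)\<^sup>2)"
    using Suc.prems by (intro Suc.IH) (auto elim: iid_normal_mono)
  moreover have "integrable M (\<lambda>\<omega>. (Z k \<omega>)\<^sup>2)"
    using Suc.prems by (intro normal_power_integrable[of _ \<sigma>]) (auto simp: iid_normal_def)
  ultimately have "integrable M (\<lambda>\<omega>. 2 * (run_range (walk (\<lambda>l. Z l \<omega>)) k)\<^sup>2 + 2 * (Z k \<omega>)\<^sup>2)"
    by auto
  then show ?case
  proof (rule Bochner_Integration.integrable_bound)
    show "AE \<omega> in M. norm ((run_range (walk (\<lambda>l. Z l \<omega>)) (Suc k))\<^sup>2)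
        \<le> norm (2 * (run_range (walk (\<lambda>l. Z l \<omega>)) k)\<^sup>2 + 2 * (Z k \<omega>)\<^sup>2)"
    proof (intro AE_I2)
      fix \<omega>
      let ?r = "run_range (walk (\<lambda>l. Z l \<omega>)) k"
      have "run_range (walk (\<lambda>l. Z l \<omega>)) (Suc k) \<le> ?r + \<bar>Z k \<omega>\<bar>"
        using run_range_Suc_le[of "walk (\<lambda>l. Z l \<omega>)" k] by (simp add: walk_Suc)
      then have "(run_range (walk (\<lambda>l. Z l \<omega>)) (Suc k))\<^sup>2 \<le> (?r + \<bar>Z k \<omega>\<bar>)\<^sup>2"
        by (intro power_mono run_range_nonneg)
      also have "\<dots> \<le> 2 * ?r\<^sup>2 + 2 * (Z k \<omega>)\<^sup>2"
        using sum_squares_ge_zero[of "?r - \<bar>Z k \<omega>\<bar>" 0] by (simp add: power2_eq_square algebra_simps)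
      finally show "norm ((run_range (walk (\<lambda>l. Z l \<omega>)) (Suc k))\<^sup>2) \<le> norm (2 * ?r\<^sup>2 + 2 * (Z k \<omega>)\<^sup>2)"
        by simp
    qed
  qed (intro borel_measurable_power run_range_measurable walk_measurable m; simp)
qed

text \<open>
Let the step first act with the old extrema, which multiplies the mean by \<open>exp (2 * \<sigma>\<^sup>2)\<close>, and update
the extrema afterwards, which by \<open>lyapunov_update\<close> lowers the value by at least half the growth of
the squared range.
\<close>

lemma normal_walk_lyapunov_step:
  assumes Z: "iid_normal \<sigma> {..<Suc k} Z"
  defines "X \<equiv> \<lambda>\<omega>. walk (\<lambda>l. Z l \<omega>)"
  defines "V \<equiv> \<lambda>k. expectation (\<lambda>\<omega>. lyapunov (X \<omega> k) (run_max (X \<omega>) k) (run_min (X \<omega>) k))"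
  defines "\<rho> \<equiv> \<lambda>k. expectation (\<lambda>\<omega>. (run_range (X \<omega>) k)\<^sup>2)"
  shows "V (Suc k) + (\<rho> (Suc k) - \<rho> k) / 2 \<le> exp (2 * \<sigma>\<^sup>2) * V k"
proof -
  note m = iid_normal_measurable[OF Z]
  have Zk: "iid_normal \<sigma> {..<k} Z"
    by (rule iid_normal_mono[OF Z]) auto
  have s: "0 < \<sigma>" and n: "distributed M lborel (Z k) (normal_density 0 \<sigma>)"
    using Z by (auto simp: iid_normal_def)
  have X_m [measurable]: "(\<lambda>\<omega>. X \<omega> j) \<in> borel_measurable M" if "j \<le> Suc k" for j
    unfolding X_def using that by (intro walk_measurable m) auto
  have [measurable]: "Z k \<in> borel_measurable M" by (rule m) simp
  have [measurable]: "(\<lambda>\<omega>. run_max (X \<omega>) j) \<in> borel_measurable M"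
     "(\<lambda>\<omega>. run_min (X \<omega>) j) \<in> borel_measurable M"  "(\<lambda>\<omega>. run_range (X \<omega>) j) \<in> borel_measurable M"
     if "j \<le> Suc k" for j
    using that by (intro run_max_measurable run_min_measurable run_range_measurable X_m; simp)+
  define U where "U = (\<lambda>\<omega>. lyapunov_up (X \<omega> k) (run_max (X \<omega>) k) (run_min (X \<omega>) k))"
  define D where "D = (\<lambda>\<omega>. lyapunov_down (X \<omega> k) (run_max (X \<omega>) k) (run_min (X \<omega>) k))"
  have [measurable]: "U \<in> borel_measurable M" "D \<in> borel_measurable M"
    unfolding U_def D_def by measurable
  have r2: "integrable M (\<lambda>\<omega>. (run_range (X \<omega>) k)\<^sup>2)" "integrable M (\<lambda>\<omega>. (run_range (X \<omega>) (Suc k))\<^sup>2)"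
    unfolding X_def by (intro normal_walk_range_sq_integrable[of \<sigma>] Z Zk)+
  have bounds: "0 \<le> U \<omega>" "0 \<le> D \<omega>" "U \<omega> \<le> 2 + (run_range (X \<omega>) k)\<^sup>2" "D \<omega> \<le> 2 + (run_range (X \<omega>) k)\<^sup>2" for \<omega>
  proof -
    \<comment> \<open>A bound in terms of the squared range, whose integrability is known.\<close>
    have "1 + 2 * r \<le> 2 + r\<^sup>2" for r :: real
      using zero_le_power2[of "r - 1"] by (simp add: power2_eq_square algebra_simps)
    from this[of "run_range (X \<omega>) k"]
    show "0 \<le> U \<omega>" "0 \<le> D \<omega>" "U \<omega> \<le> 2 + (run_range (X \<omega>) k)\<^sup>2" "D \<omega> \<le> 2 + (run_range (X \<omega>) k)\<^sup>2"
      using lyapunov_parts_bounds[OF run_bounds[of k k "X \<omega>"]]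
      unfolding U_def D_def run_range_def by auto
  qed
  have dom: "integrable M (\<lambda>\<omega>. 2 + (run_range (X \<omega>) k)\<^sup>2)"
    using r2(1) by simp
  have int: "integrable M U" "integrable M D"
    by (rule Bochner_Integration.integrable_bound[OF dom]; simp add: bounds)+
  have past: "integrable M (\<lambda>\<omega>. F (X \<omega> k) (run_max (X \<omega>) k) (run_min (X \<omega>) k) * exp (c * Z k \<omega>)) \<and>
      expectation (\<lambda>\<omega>. F (X \<omega> k) (run_max (X \<omega>) k) (run_min (X \<omega>) k) * exp (c * Z k \<omega>))
        = exp (c\<^sup>2 * \<sigma>\<^sup>2 / 2) * expectation (\<lambda>\<omega>. F (X \<omega> k) (run_max (X \<omega>) k) (run_min (X \<omega>) k))"
    if F: "(\<lambda>z. F (walk z k) (run_max (walk z) k) (run_min (walk z) k)) \<in> borel_measurable (\<Pi>\<^sub>M i\<in>{..<k}. borel)"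
      and i: "integrable M (\<lambda>\<omega>. F (X \<omega> k) (run_max (X \<omega>) k) (run_min (X \<omega>) k))"
    for F :: "real \<Rightarrow> real \<Rightarrow> real \<Rightarrow> real" and c
  proof -
    define f where "f = (\<lambda>z. F (walk z k) (run_max (walk z) k) (run_min (walk z) k))"
    have f: "f (\<lambda>i\<in>{..<k}. Z i \<omega>) = F (X \<omega> k) (run_max (X \<omega>) k) (run_min (X \<omega>) k)" for \<omega>
      unfolding f_def X_def by (simp add: walk_restrict cong: run_cong)
    have fm: "f \<in> borel_measurable (\<Pi>\<^sub>M i\<in>{..<k}. borel)" using F by (simp add: f_def)
    have g: "(\<lambda>x :: real. exp (c * x)) \<in> borel_measurable borel" by measurable
    have "integrable M (\<lambda>\<omega>. f (\<lambda>i\<in>{..<k}. Z i \<omega>))" unfolding f by (rule i)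
    from iid_normal_past_times_present[OF Z _ _ _ fm g this normal_exp_moment(1)[OF n s]]
    show ?thesis
      unfolding f by (simp add: normal_exp_moment[OF n s] subset_eq)
  qed
  have meas: "(\<lambda>z. lyapunov_up (walk z k) (run_max (walk z) k) (run_min (walk z) k)) \<in> borel_measurable (\<Pi>\<^sub>M i\<in>{..<k}. borel)"
    "(\<lambda>z. lyapunov_down (walk z k) (run_max (walk z) k) (run_min (walk z) k)) \<in> borel_measurable (\<Pi>\<^sub>M i\<in>{..<k}. borel)"
    by (intro lyapunov_measurable run_max_measurable run_min_measurable walk_component_measurable; simp)+
  from past[OF meas(1), of 2] int(1)
  have up: "integrable M (\<lambda>\<omega>. U \<omega> * exp (2 * Z k \<omega>))"
      "expectation (\<lambda>\<omega>. U \<omega> * exp (2 * Z k \<omega>)) = exp (2 * \<sigma>\<^sup>2) * expectation U"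
    by (simp_all add: U_def)
  from past[OF meas(2), of "- 2"] int(2)
  have down: "integrable M (\<lambda>\<omega>. D \<omega> * exp (- 2 * Z k \<omega>))"
      "expectation (\<lambda>\<omega>. D \<omega> * exp (- 2 * Z k \<omega>)) = exp (2 * \<sigma>\<^sup>2) * expectation D"
    by (simp_all add: D_def)
  let ?L = "\<lambda>\<omega>. lyapunov (X \<omega> (Suc k)) (run_max (X \<omega>) (Suc k)) (run_min (X \<omega>) (Suc k))"
  have le: "?L \<omega> + ((run_range (X \<omega>) (Suc k))\<^sup>2 - (run_range (X \<omega>) k)\<^sup>2) / 2
      \<le> U \<omega> * exp (2 * Z k \<omega>) + D \<omega> * exp (- 2 * Z k \<omega>)" for \<omega>
    using lyapunov_update[OF run_min_le_max[of "X \<omega>" k], of "X \<omega> (Suc k)"]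
    by (simp add: U_def D_def run_range_def run_max_Suc run_min_Suc X_def walk_Suc lyapunov_shift)
  have L: "integrable M ?L"
  proof (rule Bochner_Integration.integrable_bound)
    show "integrable M (\<lambda>\<omega>. U \<omega> * exp (2 * Z k \<omega>) + D \<omega> * exp (- 2 * Z k \<omega>) + (run_range (X \<omega>) k)\<^sup>2 / 2)"
      using up down r2 by auto
    show "AE \<omega> in M. norm (?L \<omega>) \<le> norm (U \<omega> * exp (2 * Z k \<omega>) + D \<omega> * exp (- 2 * Z k \<omega>) + (run_range (X \<omega>) k)\<^sup>2 / 2)"
    proof (intro AE_I2)
      fix \<omega>
      have "l \<le> t + q / 2" if "l + (p - q) / 2 \<le> t" "0 \<le> p" for l p q t :: real
        using that by (simp add: field_simps)
      from this[OF le zero_le_power2]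
      have "?L \<omega> \<le> U \<omega> * exp (2 * Z k \<omega>) + D \<omega> * exp (- 2 * Z k \<omega>) + (run_range (X \<omega>) k)\<^sup>2 / 2" .
      moreover have "0 \<le> ?L \<omega>" by (intro lyapunov_nonneg run_bounds) auto
      ultimately show "norm (?L \<omega>) \<le> norm (U \<omega> * exp (2 * Z k \<omega>) + D \<omega> * exp (- 2 * Z k \<omega>) + (run_range (X \<omega>) k)\<^sup>2 / 2)"
        by simp
    qed
  qed measurable
  have "V (Suc k) + (\<rho> (Suc k) - \<rho> k) / 2
      = expectation (\<lambda>\<omega>. ?L \<omega> + ((run_range (X \<omega>) (Suc k))\<^sup>2 - (run_range (X \<omega>) k)\<^sup>2) / 2)"
    unfolding V_def \<rho>_def using L r2 by simp
  also have "\<dots> \<le> expectation (\<lambda>\<omega>. U \<omega> * exp (2 * Z k \<omega>) + D \<omega> * exp (- 2 * Z k \<omega>))"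
    using L r2 up(1) down(1) le by (intro integral_mono) auto
  also have "\<dots> = exp (2 * \<sigma>\<^sup>2) * expectation (\<lambda>\<omega>. U \<omega> + D \<omega>)"
    using up down int by (simp add: distrib_left)
  also have "(\<lambda>\<omega>. U \<omega> + D \<omega>) = (\<lambda>\<omega>. lyapunov (X \<omega> k) (run_max (X \<omega>) k) (run_min (X \<omega>) k))"
    using lyapunov_shift[of _ 0] by (simp add: U_def D_def)
  finally show ?thesis by (simp add: V_def)
qed

text \<open>
Discounting the one-step inequality by \<open>exp (- 2 * \<sigma>\<^sup>2)\<close> per step makes it telescope. The starting value
of the Lyapunov function is \<open>ln 2\<close>.
\<close>

lemma normal_walk_discounted_range:
  assumes Z: "iid_normal \<sigma> {..<N} Z"
  defines "\<rho> \<equiv> \<lambda>k. expectation (\<lambda>\<omega>. (run_range (walk (\<lambda>l. Z l \<omega>)) k)\<^sup>2)"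
  shows "(\<Sum>k<N. exp (- 2 * \<sigma>\<^sup>2 * real (Suc k)) * (\<rho> (Suc k) - \<rho> k)) \<le> 2 * ln 2"
proof -
  define X where "X = (\<lambda>\<omega>. walk (\<lambda>l. Z l \<omega>))"
  define V where "V = (\<lambda>k. expectation (\<lambda>\<omega>. lyapunov (X \<omega> k) (run_max (X \<omega>) k) (run_min (X \<omega>) k)))"
  have "(\<Sum>k<K. exp (- 2 * \<sigma>\<^sup>2 * real (Suc k)) * (\<rho> (Suc k) - \<rho> k)) / 2
      \<le> ln 2 - exp (- 2 * \<sigma>\<^sup>2 * real K) * V K" if "K \<le> N" for K
    using that
  proof (induction K)
    case 0
    show ?case by (simp add: V_def X_def lyapunov_def prob_space)
  next
    case (Suc K)
    have "V (Suc K) + (\<rho> (Suc K) - \<rho> K) / 2 \<le> exp (2 * \<sigma>\<^sup>2) * V K"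
      unfolding V_def \<rho>_def X_def using Suc.prems
      by (intro normal_walk_lyapunov_step) (auto intro: iid_normal_mono[OF Z])
    then have "exp (- 2 * \<sigma>\<^sup>2 * real (Suc K)) * (V (Suc K) + (\<rho> (Suc K) - \<rho> K) / 2)
        \<le> exp (- 2 * \<sigma>\<^sup>2 * real (Suc K)) * (exp (2 * \<sigma>\<^sup>2) * V K)"
      by (intro mult_left_mono) auto
    also have "\<dots> = exp (- 2 * \<sigma>\<^sup>2 * real K) * V K"
      by (simp add: algebra_simps flip: exp_add)
    finally show ?case
      using Suc.IH Suc.prems by (simp add: field_simps)
  qed
  from this[of N] moreover have "0 \<le> V N"
    unfolding V_def by (intro integral_nonneg_AE AE_I2 lyapunov_nonneg run_bounds) auto
  ultimately show ?thesis by (smt (verit) field_sum_of_halves mult_nonneg_nonneg exp_ge_zero order_refl)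
qed

end

section \<open>The mean squared range of one-dimensional Brownian motion\<close>

text \<open>
An Abelian argument in the parameter \<open>s\<close>. Cut the time axis into blocks of length \<open>k\<close>. Replacing the
weights by their value at the end of each block, and then \<open>r (j * k)\<close> by \<open>j * r k\<close> in a summation by
parts, leaves a geometric series, which for small \<open>s\<close> behaves like \<open>r k / (s * k)\<close>.
\<close>

lemma superadditive_growth_bound:
  fixes r :: "nat \<Rightarrow> real"
  assumes zero: "r 0 = 0" and mono: "\<And>k. r k \<le> r (Suc k)"
    and block: "\<And>j k. real j * r k \<le> r (j * k)"
    and disc: "\<And>s N. 0 < s \<Longrightarrow> (\<Sum>k<N. exp (- s * real (Suc k)) * (r (Suc k) - r k)) \<le> c / s"
  shows "r k \<le> c * real k"
proof (cases "k = 0")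
  case False
  have main: "r k * exp (- s * real k) \<le> c * real k" if s: "0 < s" for s
  proof -
    define w where "w = exp (- s * real k)"
    have w: "0 < w" "w < 1" "1 - w \<le> s * real k"
      using s False exp_ge_add_one_self[of "- s * real k"] by (auto simp: w_def)
    have pw: "exp (- s * real (j * k)) = w ^ j" for j
      by (simp add: w_def exp_of_nat_mult[symmetric] algebra_simps)
    have fin: "r k * (w * (1 - w ^ J)) \<le> (1 - w) * (c / s)" for J
    proof -
      define d where "d = (\<lambda>j. r (j * k) - real j * r k)"
      have d: "0 \<le> d j" for j using block[of j k] by (simp add: d_def)
      have "w ^ J * d J \<le> (\<Sum>j<J. w ^ Suc j * (d (Suc j) - d j))"
      proof (induction J)
        case 0
        show ?case by (simp add: d_def zero)
      next
        case (Suc J)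
        have "w ^ Suc J * d (Suc J) = w ^ J * d J + w ^ Suc J * (d (Suc J) - d J) - w ^ J * (1 - w) * d J"
          by (simp add: algebra_simps)
        also have "\<dots> \<le> w ^ J * d J + w ^ Suc J * (d (Suc J) - d J)"
          using w d[of J] by simp
        finally show ?case using Suc by simp
      qed
      then have "0 \<le> (\<Sum>j<J. w ^ Suc j * (d (Suc j) - d j))"
        using w d[of J] by (auto intro: order.trans[rotated])
      also have "\<dots> = (\<Sum>j<J. w ^ Suc j * (r (Suc j * k) - r (j * k))) - (\<Sum>j<J. w ^ Suc j * r k)"
        by (simp add: d_def algebra_simps flip: sum_subtractf)
      finally have "(\<Sum>j<J. w ^ Suc j * r k) \<le> (\<Sum>j<J. w ^ Suc j * (r (Suc j * k) - r (j * k)))" by simp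
      also have "\<dots> \<le> (\<Sum>j<J. \<Sum>i\<in>{j * k..<j * k + k}. exp (- s * real (Suc i)) * (r (Suc i) - r i))"
      proof (rule sum_mono)
        fix j
        have "w ^ Suc j * (r (Suc j * k) - r (j * k)) = w ^ Suc j * (\<Sum>i\<in>{j * k..<j * k + k}. r (Suc i) - r i)"
          by (subst sum_Suc_diff') (auto simp: algebra_simps)
        also have "\<dots> \<le> (\<Sum>i\<in>{j * k..<j * k + k}. exp (- s * real (Suc i)) * (r (Suc i) - r i))"
          unfolding sum_distrib_left
        proof (rule sum_mono)
          fix i assume i: "i \<in> {j * k..<j * k + k}"
          then have "Suc i \<le> Suc j * k" by simp
          then have "s * real (Suc i) \<le> s * real (Suc j * k)" using s by (intro mult_left_mono) (simp_all only: of_nat_le_iff less_imp_le)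
          then have "w ^ Suc j \<le> exp (- s * real (Suc i))"
            unfolding pw[symmetric] by simp
          then show "w ^ Suc j * (r (Suc i) - r i) \<le> exp (- s * real (Suc i)) * (r (Suc i) - r i)"
            using mono[of i] by (intro mult_right_mono) auto
        qed
        finally show "w ^ Suc j * (r (Suc j * k) - r (j * k))
          \<le> (\<Sum>i\<in>{j * k..<j * k + k}. exp (- s * real (Suc i)) * (r (Suc i) - r i))" .
      qed
      also have "\<dots> = (\<Sum>i<J * k. exp (- s * real (Suc i)) * (r (Suc i) - r i))"
        by (rule sum.nat_group)
      also have "\<dots> \<le> c / s" by (rule disc[OF s])
      finally have "(1 - w) * (\<Sum>j<J. w ^ Suc j * r k) \<le> (1 - w) * (c / s)"
        using w by (intro mult_left_mono) auto
      moreover have "(1 - w) * (\<Sum>j<J. w ^ Suc j * r k) = r k * (w * (1 - w ^ J))"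
      proof -
        have "(\<Sum>j<J. w ^ Suc j * r k) = r k * w * (\<Sum>j<J. w ^ j)"
          by (simp add: sum_distrib_left ac_simps)
        then show ?thesis
          using w by (simp add: sum_gp_strict field_simps)
      qed
      ultimately show ?thesis by simp
    qed
    have "(\<lambda>J. r k * (w * (1 - w ^ J))) \<longlonglongrightarrow> r k * (w * (1 - 0))"
      using w by (intro tendsto_intros LIMSEQ_power_zero) auto
    then have "r k * w \<le> (1 - w) * (c / s)"
      using fin by (intro LIMSEQ_le_const2) (auto intro!: exI[of _ 0])
    also have "\<dots> \<le> (s * real k) * (c / s)"
    proof (intro mult_right_mono w)
      have "0 \<le> c / s" using disc[OF s, of 0] by simp
      then show "0 \<le> c / s" .
    qed
    finally show ?thesis using s by (simp add: w_def mult.commute)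
  qed
  have "((\<lambda>s. r k * exp (- s * real k)) \<longlongrightarrow> r k * exp (- 0 * real k)) (at_right 0)"
    by (intro tendsto_intros)
  moreover have "\<forall>\<^sub>F s in at_right 0. r k * exp (- s * real k) \<le> c * real k"
    using eventually_at_right_less[of 0] by eventually_elim (rule main)
  ultimately have "r k * exp (- 0 * real k) \<le> c * real k"
    by (rule tendsto_upperbound) simp
  then show ?thesis by simp
qed (simp add: zero)

context std_brownian_motion
begin

definition step :: "real \<Rightarrow> nat \<Rightarrow> 'a \<Rightarrow> real" where
  "step h l \<omega> = B (real (Suc l) * h) \<omega> - B (real l * h) \<omega>"

lemma walk_step: "walk (\<lambda>l. step h l \<omega>) k = B (real k * h) \<omega> - B 0 \<omega>"
  by (induction k) (simp_all add: walk_Suc step_def)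

lemma iid_normal_step:
  assumes "0 < h" shows "iid_normal (sqrt h) {..<k} (step h)"
  unfolding iid_normal_def
proof (intro conjI ballI)
  show "indep_vars (\<lambda>_. borel) (step h) {..<k}"
    unfolding step_def[abs_def] using assms by (intro independent_increments) auto
  fix l
  show "distributed M lborel (step h l) (normal_density 0 (sqrt h))"
    using normal_increments[of "real l * h" "real (Suc l) * h"] assms
    by (simp add: step_def[abs_def] algebra_simps)
qed (use assms in simp)

definition mean_sq_range :: "nat \<Rightarrow> real" where
  "mean_sq_range k = expectation (\<lambda>\<omega>. (run_range (\<lambda>j. B (real j) \<omega>) k)\<^sup>2)"

text \<open>
The walk of the increments is the path relative to its starting point, and the range does not see the
starting point.
\<close>

lemma run_range_walk_step:
  "run_range (walk (\<lambda>l. step h l \<omega>)) k = run_range (\<lambda>j. B (real j * h) \<omega>) k"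
  using run_range_affine[of 1 "\<lambda>j. B (real j * h) \<omega>" "- B 0 \<omega>" k]
  by (simp add: walk_step fun_eq_iff cong: run_cong)

lemma mesh_range_sq_integrable:
  assumes "0 < h" shows "integrable M (\<lambda>\<omega>. (run_range (\<lambda>j. B (real j * h) \<omega>) k)\<^sup>2)"
  using normal_walk_range_sq_integrable[OF iid_normal_step[OF assms]] by (simp add: run_range_walk_step)

lemma mean_sq_range_scaling:
  assumes h: "0 < h"
  shows "expectation (\<lambda>\<omega>. (run_range (\<lambda>j. B (real j * h) \<omega>) k)\<^sup>2) = h * mean_sq_range k"
proof -
  define f where "f = (\<lambda>z. (run_range (walk z) k)\<^sup>2)"
  have f: "f (\<lambda>i\<in>{..<k}. z i) = (run_range (walk z) k)\<^sup>2" for z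
    unfolding f_def by (simp add: walk_restrict cong: run_cong)
  have "expectation (\<lambda>\<omega>. f (\<lambda>i\<in>{..<k}. step h i \<omega>)) = expectation (\<lambda>\<omega>. f (\<lambda>i\<in>{..<k}. sqrt h * step 1 i \<omega>))"
  proof (rule iid_normal_transfer)
    show "iid_normal (sqrt h) {..<k} (step h)" by (rule iid_normal_step[OF h])
    show "iid_normal (sqrt h) {..<k} (\<lambda>i \<omega>. sqrt h * step 1 i \<omega>)"
      using iid_normal_scale[OF iid_normal_step[of 1 k], of "sqrt h"] h by simp
    show "f \<in> borel_measurable (\<Pi>\<^sub>M i\<in>{..<k}. borel)"
      unfolding f_def by (intro borel_measurable_power run_range_measurable walk_component_measurable)
  qed
  moreover have "run_range (walk (\<lambda>l. sqrt h * step 1 l \<omega>)) k = sqrt h * run_range (\<lambda>j. B (real j) \<omega>) k" for \<omega>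
  proof -
    have "walk (\<lambda>l. sqrt h * step 1 l \<omega>) = (\<lambda>j. sqrt h * walk (\<lambda>l. step 1 l \<omega>) j)"
      by (simp add: fun_eq_iff walk_def sum_distrib_left)
    then show ?thesis
      using run_range_affine[of "sqrt h" "walk (\<lambda>l. step 1 l \<omega>)" 0 k] run_range_walk_step[of 1 \<omega> k] h by simp
  qed
  ultimately show ?thesis
    using h by (simp add: f run_range_walk_step mean_sq_range_def power_mult_distrib)
qed

text \<open>
This is the sharp constant: the squared range of Brownian motion up to time \<open>1\<close> has mean \<open>4 * ln 2\<close>.
By scaling, the discounted inequality for walks of step variance \<open>t\<close> is an inequality with parameter
\<open>2 * t\<close> for the unit walk, and sampling a path at fewer times does not enlarge its range.
\<close>

lemma mean_sq_range_le: "mean_sq_range k \<le> 4 * ln 2 * real k"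
proof (rule superadditive_growth_bound)
  note int = mesh_range_sq_integrable[of 1, simplified]
  show "mean_sq_range 0 = 0" by (simp add: mean_sq_range_def)
  have le: "(run_range (\<lambda>j. B (real j) \<omega>) k)\<^sup>2 \<le> (run_range (\<lambda>j. B (real j) \<omega>) l)\<^sup>2" if "k \<le> l" for k l \<omega>
    using that by (intro power_mono run_range_nonneg run_range_subsequence[where f="\<lambda>j. j"]) auto
  show "mean_sq_range k \<le> mean_sq_range (Suc k)" for k
    unfolding mean_sq_range_def by (intro integral_mono int le) simp
  show "real j * mean_sq_range k \<le> mean_sq_range (j * k)" for j k
  proof (cases "j = 0")
    case False
    have "real j * mean_sq_range k = expectation (\<lambda>\<omega>. (run_range (\<lambda>i. B (real i * real j) \<omega>) k)\<^sup>2)"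
      using False by (simp add: mean_sq_range_scaling)
    also have "\<dots> \<le> mean_sq_range (j * k)"
      unfolding mean_sq_range_def
    proof (intro integral_mono int mesh_range_sq_integrable)
      fix \<omega>
      have "run_range (\<lambda>i. B (real (i * j)) \<omega>) k \<le> run_range (\<lambda>i. B (real i) \<omega>) (j * k)"
        by (intro run_range_subsequence[where x="\<lambda>i. B (real i) \<omega>"]) simp
      then show "(run_range (\<lambda>i. B (real i * real j) \<omega>) k)\<^sup>2 \<le> (run_range (\<lambda>i. B (real i) \<omega>) (j * k))\<^sup>2"
        by (intro power_mono run_range_nonneg) simp
    qed (use False in simp)
    finally show ?thesis .
  qed (simp add: mean_sq_range_def)
  fix s :: real and N assume s: "0 < s"
  define t where "t = s / 2"
  have t: "0 < t" "s = 2 * t" using s by (simp_all add: t_def)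
  have "(\<Sum>k<N. exp (- s * real (Suc k)) * (t * mean_sq_range (Suc k) - t * mean_sq_range k)) \<le> 2 * ln 2"
    using normal_walk_discounted_range[OF iid_normal_step[of t N]] t
    unfolding run_range_walk_step mean_sq_range_scaling[OF t(1)] by (simp add: t(2))
  then have "t * (\<Sum>k<N. exp (- s * real (Suc k)) * (mean_sq_range (Suc k) - mean_sq_range k)) \<le> 2 * ln 2"
    by (simp only: sum_distrib_left right_diff_distrib mult.left_commute)
  then show "(\<Sum>k<N. exp (- s * real (Suc k)) * (mean_sq_range (Suc k) - mean_sq_range k)) \<le> 4 * ln 2 / s"
    unfolding t(2) using t(1) by (simp add: pos_le_divide_eq mult.commute)
qed

end

section \<open>Increments of multidimensional Brownian motion\<close>

context std_brownian_motion_vec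
begin

definition increment :: "real \<Rightarrow> nat \<times> 'n \<Rightarrow> 'a \<Rightarrow> real" where
  "increment h p \<omega> = (W (real (Suc (fst p)) * h) \<omega> - W (real (fst p) * h) \<omega>) $ snd p"

lemma coordinate_measurable: "0 \<le> t \<Longrightarrow> (\<lambda>\<omega>. W t \<omega> $ i) \<in> borel_measurable M"
  by (rule std_brownian_motion.random_variable_at[OF coordinates])

lemma W_measurable: "0 \<le> t \<Longrightarrow> W t \<in> borel_measurable M"
proof -
  assume t: "0 \<le> t"
  have "(\<lambda>\<omega>. W t \<omega> \<bullet> b) \<in> borel_measurable M" if "b \<in> Basis" for b
    using that coordinate_measurable[OF t] by (auto simp: Basis_vec_def inner_axis)
  then show ?thesis by (simp add: borel_measurable_euclidean_space[where f="W t"])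
qed

lemma increment_measurable: "0 < h \<Longrightarrow> increment h p \<in> borel_measurable M"
  unfolding increment_def[abs_def] vector_minus_component
  by (intro borel_measurable_diff coordinate_measurable) simp_all

lemma increment_coordinate: "(\<lambda>l. increment h (l, i)) = std_brownian_motion.step (\<lambda>t \<omega>. W t \<omega> $ i) h"
  by (simp add: fun_eq_iff increment_def std_brownian_motion.step_def[OF coordinates])

text \<open>
Independence of the coordinate processes and independence of the increments within each coordinate
combine to independence over all pairs of a time step and a coordinate, since the probability of a
box factors first over coordinates and then over time steps.
\<close>

lemma iid_normal_increment:
  assumes h: "0 < h"
  shows "iid_normal (sqrt h) ({..<k} \<times> UNIV) (increment h)"
proof -
  have coord: "iid_normal (sqrt h) {..<k} (\<lambda>l. increment h (l, i))" for i
    unfolding increment_coordinate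
    by (rule std_brownian_motion.iid_normal_step[OF coordinates h])
  have "indep_vars (\<lambda>_. borel) (increment h) ({..<k} \<times> UNIV)"
  proof (cases "k = 0")
    case True
    then show ?thesis by (simp add: indep_vars_def indep_sets_def)
  next
    case False
    let ?I = "{..<k} \<times> (UNIV :: 'n set)"
    have "prob (\<Inter>p\<in>?I. increment h p -` A p \<inter> space M) = (\<Prod>p\<in>?I. prob (increment h p -` A p \<inter> space M))"
      if A: "A \<in> ?I \<rightarrow> sets borel" for A
    proof -
      define P where "P = (\<Pi>\<^sub>M t\<in>{0 :: real..}. borel :: real measure)"
      define C where "C i = {f \<in> space P. \<forall>l<k. f (real (Suc l) * h) - f (real l * h) \<in> A (l, i)}" for i
      have C: "C i \<in> sets P" for i
      proof -
        have "(\<lambda>f. f (real (Suc l) * h) - f (real l * h)) -` A (l, i) \<inter> space P \<in> sets P" if "l < k" for l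
          using that A h unfolding P_def
          by (intro measurable_sets[of _ _ borel] borel_measurable_diff measurable_component_singleton) auto
        then have "(\<Inter>l<k. (\<lambda>f. f (real (Suc l) * h) - f (real l * h)) -` A (l, i) \<inter> space P) \<in> sets P"
          using False by (intro sets.finite_INT) auto
        also have "(\<Inter>l<k. (\<lambda>f. f (real (Suc l) * h) - f (real l * h)) -` A (l, i) \<inter> space P) = C i"
          using False by (auto simp: C_def)
        finally show ?thesis .
      qed
      have vimage: "(\<lambda>\<omega>. \<lambda>t\<in>{0..}. W t \<omega> $ i) -` C i \<inter> space M
          = (\<Inter>l<k. increment h (l, i) -` A (l, i) \<inter> space M)" for i
        using False h by (auto simp: C_def P_def space_PiM increment_def)
      have "(\<Inter>p\<in>?I. increment h p -` A p \<inter> space M)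
          = (\<Inter>i\<in>UNIV. (\<lambda>\<omega>. \<lambda>t\<in>{0..}. W t \<omega> $ i) -` C i \<inter> space M)"
        unfolding vimage using False by auto
      then have "prob (\<Inter>p\<in>?I. increment h p -` A p \<inter> space M)
          = (\<Prod>i\<in>UNIV. prob ((\<lambda>\<omega>. \<lambda>t\<in>{0..}. W t \<omega> $ i) -` C i \<inter> space M))"
        using C by (simp only:) (intro indep_varsD_finite[OF independent_coordinates], auto simp: P_def)
      also have "\<dots> = (\<Prod>i\<in>UNIV. \<Prod>l<k. prob (increment h (l, i) -` A (l, i) \<inter> space M))"
        unfolding vimage using False A coord
        by (intro prod.cong indep_varsD_finite[where M'="\<lambda>_. borel"]) (auto simp: iid_normal_def)
      also have "\<dots> = (\<Prod>p\<in>?I. prob (increment h p -` A p \<inter> space M))"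
        by (subst prod.swap) (simp add: prod.cartesian_product case_prod_beta)
      finally show ?thesis .
    qed
    then show ?thesis
      using False h
      by (subst indep_vars_finite[where E="\<lambda>_. sets borel"])
         (auto simp: increment_measurable sets.sigma_sets_eq[of borel, simplified] Int_stable_def)
  qed
  then show ?thesis
    using coord h by (auto simp: iid_normal_def)
qed

end

definition vec_walk :: "(nat \<times> 'n \<Rightarrow> real) \<Rightarrow> nat \<Rightarrow> real ^ 'n" where
  "vec_walk z k = (\<chi> i. \<Sum>l<k. z (l, i))"

lemma vec_walk_0 [simp]: "vec_walk z 0 = 0"
  by (simp add: vec_walk_def vec_eq_iff)

lemma vec_walk_Suc: "vec_walk z (Suc k) = vec_walk z k + (\<chi> i. z (k, i))"
  by (simp add: vec_walk_def vec_eq_iff)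

lemma vec_walk_restrict: "j \<le> k \<Longrightarrow> vec_walk (\<lambda>p\<in>{..<k} \<times> UNIV. z p) j = vec_walk z j"
  by (auto simp: vec_walk_def vec_eq_iff intro!: sum.cong)

lemma vec_walk_scale: "vec_walk (\<lambda>p. c * z p) k = c *\<^sub>R vec_walk z k"
  by (simp add: vec_walk_def vec_eq_iff sum_distrib_left)

lemma vec_walk_norm_measurable:
  fixes j k :: nat
  assumes "j \<le> k"
  shows "(\<lambda>z. norm (vec_walk z j :: real ^ 'n)) \<in> borel_measurable (\<Pi>\<^sub>M p\<in>{..<k} \<times> (UNIV :: 'n set). borel)"
  unfolding norm_vec_def L2_set_def vec_walk_def using assms by simp

section \<open>The running maximum of a nonnegative sequence\<close>

text \<open>
The floor \<open>s\<close> keeps the reciprocal of the maximum bounded near time \<open>0\<close>.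
\<close>

definition floored_max :: "real \<Rightarrow> (nat \<Rightarrow> real) \<Rightarrow> nat \<Rightarrow> real" where
  "floored_max s x k = max s (run_max x k)"

lemma floored_max_Suc: "floored_max s x (Suc k) = max (floored_max s x k) (x (Suc k))"
  by (simp add: floored_max_def run_max_Suc max.assoc)

lemma floored_max_ge: "s \<le> floored_max s x k" "j \<le> k \<Longrightarrow> x j \<le> floored_max s x k"
  using run_bounds(2)[of j k x] by (auto simp: floored_max_def)

text \<open>
If \<open>x\<close> were continuous, the integral of \<open>1 / S\<close> against \<open>x\<^sup>2\<close> would be computed by parts, because \<open>S\<close> grows
only when \<open>x = S\<close>. In discrete time the maximum may overshoot, which adds \<open>e\<^sup>2 / S k\<close> where \<open>e\<close> is the
growth of \<open>S\<close>. As \<open>e\<close> is at most the step size \<open>d\<close>, the truncation \<open>e\<^sup>2 \<le> L * e + d ^ 4 / L\<^sup>2\<close> keeps this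
error small on average.
\<close>

lemma floored_max_increment:
  fixes x :: "nat \<Rightarrow> real"
  assumes s: "0 < s" and L: "0 < L" and x: "\<And>k. 0 \<le> x k" and d: "x (Suc k) \<le> x k + d" "0 \<le> d"
  defines "S \<equiv> floored_max s x"
  shows "((x (Suc k))\<^sup>2 - (x k)\<^sup>2) / S k
    \<le> ((x (Suc k))\<^sup>2 / S (Suc k) - (x k)\<^sup>2 / S k) + (1 + L / s) * (S (Suc k) - S k) + d ^ 4 / (L\<^sup>2 * s)"
proof -
  have pos: "0 < S k" "0 < S (Suc k)" and sS: "s \<le> S k" 
    using s floored_max_ge(1)[of s x] by (auto simp: S_def intro: less_le_trans)
  have xS: "x (Suc k) \<le> S (Suc k)" unfolding S_def by (rule floored_max_ge) simp
  define e where "e = S (Suc k) - S k"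
  have e: "0 \<le> e" "e \<le> d"
    using floored_max_ge(2)[of k k x s] d by (auto simp: e_def S_def floored_max_Suc)
  have "(x (Suc k))\<^sup>2 / S k - (x (Suc k))\<^sup>2 / S (Suc k) = (x (Suc k))\<^sup>2 * (e / (S k * S (Suc k)))"
    using pos by (simp add: e_def field_simps)
  also have "\<dots> \<le> (S (Suc k))\<^sup>2 * (e / (S k * S (Suc k)))"
    using pos e x xS by (intro mult_right_mono power_mono) auto
  also have "\<dots> = e + e\<^sup>2 / S k"
    using pos by (simp add: e_def field_simps power2_eq_square)
  also have "e\<^sup>2 / S k \<le> e\<^sup>2 / s"
    using sS s pos by (intro divide_left_mono) auto
  also have "e\<^sup>2 \<le> L * e + d ^ 4 / L\<^sup>2"
  proof (cases "e \<le> L")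
    case True
    then have "e\<^sup>2 \<le> L * e" using e by (simp add: power2_eq_square mult_right_mono)
    then show ?thesis using e by (simp add: add_increasing2)
  next
    case False
    have "e\<^sup>2 * L\<^sup>2 \<le> e\<^sup>2 * e\<^sup>2"
      using False L e by (intro mult_left_mono power_mono) auto
    also have "\<dots> = e ^ 4" by (simp add: power2_eq_square power4_eq_xxxx)
    also have "\<dots> \<le> d ^ 4" using e by (intro power_mono)
    finally have "e\<^sup>2 \<le> d ^ 4 / L\<^sup>2" using L by (simp add: pos_le_divide_eq)
    then show ?thesis using e L by (simp add: add_increasing)
  qed
  then have "e\<^sup>2 / s \<le> (L * e + d ^ 4 / L\<^sup>2) / s"
    using s by (intro divide_right_mono) auto
  finally have "(x (Suc k))\<^sup>2 / S k - (x (Suc k))\<^sup>2 / S (Suc k) \<le> e + (L * e + d ^ 4 / L\<^sup>2) / s"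
    by simp
  then show ?thesis
    unfolding e_def by (simp add: diff_divide_distrib add_divide_distrib algebra_simps)
qed

lemma floored_max_sum:
  fixes x :: "nat \<Rightarrow> real"
  assumes s: "0 < s" and L: "0 < L" and x: "\<And>k. 0 \<le> x k" 
    and d: "\<And>k. x (Suc k) \<le> x k + d k" "\<And>k. 0 \<le> d k"
  shows "(\<Sum>k<N. ((x (Suc k))\<^sup>2 - (x k)\<^sup>2) / floored_max s x k)
    \<le> (2 + L / s) * floored_max s x N + (\<Sum>k<N. d k ^ 4) / (L\<^sup>2 * s)"
proof -
  let ?S = "floored_max s x"
  have pos: "0 < ?S k" for k using s floored_max_ge(1)[of s x k] by simp
  have "(\<Sum>k<N. ((x (Suc k))\<^sup>2 - (x k)\<^sup>2) / ?S k)
    \<le> (\<Sum>k<N. ((x (Suc k))\<^sup>2 / ?S (Suc k) - (x k)\<^sup>2 / ?S k) + (1 + L / s) * (?S (Suc k) - ?S k) + d k ^ 4 / (L\<^sup>2 * s))"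
    using assms by (intro sum_mono floored_max_increment) auto
  also have "\<dots> = (\<Sum>k<N. (x (Suc k))\<^sup>2 / ?S (Suc k) - (x k)\<^sup>2 / ?S k)
      + (1 + L / s) * (\<Sum>k<N. ?S (Suc k) - ?S k) + (\<Sum>k<N. d k ^ 4) / (L\<^sup>2 * s)"
    by (simp add: sum.distrib sum_distrib_left sum_divide_distrib)
  also have "(\<Sum>k<N. (x (Suc k))\<^sup>2 / ?S (Suc k) - (x k)\<^sup>2 / ?S k) = (x N)\<^sup>2 / ?S N - (x 0)\<^sup>2 / ?S 0"
    by (rule sum_lessThan_telescope)
  also have "(\<Sum>k<N. ?S (Suc k) - ?S k) = ?S N - ?S 0"
    by (rule sum_lessThan_telescope)
  also have "(x N)\<^sup>2 / ?S N - (x 0)\<^sup>2 / ?S 0 \<le> ?S N"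
  proof -
    have "(x N)\<^sup>2 \<le> ?S N * ?S N"
      unfolding power2_eq_square using x floored_max_ge(2)[of N N x s] pos[of N] by (intro mult_mono) auto
    then have "(x N)\<^sup>2 / ?S N \<le> ?S N" using pos[of N] by (simp add: pos_divide_le_eq)
    moreover have "0 \<le> (x 0)\<^sup>2 / ?S 0" using pos[of 0] by simp
    ultimately show ?thesis by simp
  qed
  also have "(1 + L / s) * (?S N - ?S 0) \<le> (1 + L / s) * ?S N"
    using s L pos[of 0] by (intro mult_left_mono) auto
  finally show ?thesis by (simp add: algebra_simps)
qed

lemma sum_inverse_sqrt_ge: "2 * sqrt (real (Suc N)) - 2 \<le> (\<Sum>k=1..N. 1 / sqrt (real k))"
proof (induction N)
  case (Suc N)
  let ?a = "sqrt (real (Suc N))" and ?b = "sqrt (real (Suc (Suc N)))"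
  have "(?b - ?a) * (?b + ?a) = 1"
    by (simp add: algebra_simps flip: power2_eq_square)
  moreover have "(?b - ?a) * (2 * ?a) \<le> (?b - ?a) * (?b + ?a)"
    by (intro mult_left_mono) auto
  ultimately have "(?b - ?a) * (2 * ?a) \<le> 1" by (simp only:)
  then have "(2 * ?b - 2 * ?a) * ?a \<le> 1" by (simp only: algebra_simps)
  then have "2 * ?b - 2 * ?a \<le> 1 / ?a"
    by (subst pos_le_divide_eq) simp_all
  with Suc show ?case by simp
qed simp

lemma sum_inverse_le: "0 < N \<Longrightarrow> (\<Sum>k=1..N. 1 / real k) \<le> 1 + ln (real N)"
proof (induction N rule: nat_induct_non_zero)
  case (Suc N)
  have "1 / real (Suc N) \<le> - ln (1 - 1 / real (Suc N))"
    using ln_add_one_self_le_self2[of "- 1 / real (Suc N)"] Suc.hyps by simp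
  also have "1 - 1 / real (Suc N) = real N / real (Suc N)"
    by (simp add: field_simps)
  also have "- ln (real N / real (Suc N)) = ln (real (Suc N)) - ln (real N)"
    using Suc.hyps by (simp add: ln_div)
  finally show ?case using Suc.IH by simp
qed simp

text \<open>
Divide by \<open>sqrt N\<close> and let \<open>N\<close> grow. With the floor \<open>s = N powr (3/8)\<close> and the truncation level
\<open>L = N powr (1/4)\<close> all error terms vanish, and what remains is \<open>2 * n / m \<le> 2 * m\<close>.
\<close>

lemma sqrt_growth_constant_bound:
  fixes n m C :: real
  assumes m: "0 < m" and n: "0 \<le> n"
    and bound: "\<And>N s L. 0 < s \<Longrightarrow> 0 < L \<Longrightarrow> 0 < N \<Longrightarrow>
       n * (\<Sum>k=1..N. 1 / (m * sqrt (real k)) - s / (m\<^sup>2 * real k))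
         \<le> (2 + L / s) * (s + m * sqrt (real (Suc N))) + C * real (Suc N) / (L\<^sup>2 * s)"
  shows "n \<le> m\<^sup>2"
proof -
  have "n * ((2 * sqrt (real N + 1) - 2) / m - s * (1 + ln (real N)) / m\<^sup>2)
         \<le> (2 + L / s) * (s + m * sqrt (real N + 1)) + C * (real N + 1) / (L\<^sup>2 * s)"
    if "0 < s" "0 < L" "0 < N" for N s L
  proof -
    have "(2 * sqrt (real (Suc N)) - 2) / m - s * (1 + ln (real N)) / m\<^sup>2
        \<le> (\<Sum>k=1..N. 1 / sqrt (real k)) / m - s * (\<Sum>k=1..N. 1 / real k) / m\<^sup>2"
      using m that sum_inverse_sqrt_ge[of N] sum_inverse_le[of N]
      by (intro diff_mono divide_right_mono mult_left_mono) auto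
    also have "\<dots> = (\<Sum>k=1..N. 1 / (m * sqrt (real k)) - s / (m\<^sup>2 * real k))"
      by (simp add: sum_subtractf sum_divide_distrib sum_distrib_left mult.commute)
    finally have "n * ((2 * sqrt (real (Suc N)) - 2) / m - s * (1 + ln (real N)) / m\<^sup>2)
        \<le> n * (\<Sum>k=1..N. 1 / (m * sqrt (real k)) - s / (m\<^sup>2 * real k))"
      using n by (rule mult_left_mono)
    also note bound[OF that]
    finally show ?thesis by (simp add: add.commute)
  qed
  note b = this
  define f where "f = (\<lambda>x::real. n * ((2 * sqrt (x + 1) - 2) / m - x powr (3/8) * (1 + ln x) / m\<^sup>2) / sqrt x)"
  define g where "g = (\<lambda>x::real. ((2 + x powr (1/4) / x powr (3/8)) * (x powr (3/8) + m * sqrt (x + 1))) / sqrt x + C * ((x + 1) / ((x powr (1/4))\<^sup>2 * x powr (3/8)) / sqrt x))"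
  have "((\<lambda>x::real. ((2 * sqrt (x + 1) - 2) / m - x powr (3/8) * (1 + ln x) / m\<^sup>2) / sqrt x) \<longlongrightarrow> 2 * inverse m) at_top"
    using m by real_asymp
  then have "(f \<longlongrightarrow> n * (2 * inverse m)) at_top"
    unfolding f_def times_divide_eq_right[symmetric] by (intro tendsto_mult tendsto_const)
  then have f: "(\<lambda>N. f (real N)) \<longlonglongrightarrow> n * (2 * inverse m)"
    by (rule filterlim_compose[OF _ filterlim_real_sequentially])
  have "((\<lambda>x::real. (2 + x powr (1/4) / x powr (3/8)) * (x powr (3/8) + m * sqrt (x + 1)) / sqrt x) \<longlongrightarrow> 2 * m) at_top"
    using m by real_asymp
  moreover have "((\<lambda>x::real. (x + 1) / ((x powr (1/4))\<^sup>2 * x powr (3/8)) / sqrt x) \<longlongrightarrow> 0) at_top"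
    by real_asymp
  then have "((\<lambda>x::real. C * ((x + 1) / ((x powr (1/4))\<^sup>2 * x powr (3/8)) / sqrt x)) \<longlongrightarrow> C * 0) at_top"
    by (intro tendsto_mult tendsto_const)
  ultimately have "(g \<longlongrightarrow> 2 * m + C * 0) at_top"
    unfolding g_def by (intro tendsto_add)
  then have g: "(\<lambda>N. g (real N)) \<longlonglongrightarrow> 2 * m"
    by (intro filterlim_compose[OF _ filterlim_real_sequentially]) simp
  have "f (real N) \<le> g (real N)" if "1 \<le> N" for N
  proof -
    have split: "(a + C * p / d) / q = a / q + C * (p / d / q)" for a p d q :: real
      by (simp add: add_divide_distrib)
    show ?thesis
      unfolding f_def g_def split[symmetric] using that b[of "real N powr (3/8)" "real N powr (1/4)" N]
      by (intro divide_right_mono) auto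
  qed
  then have "n * (2 * inverse m) \<le> 2 * m"
    by (intro LIMSEQ_le[OF f g]) (auto intro!: exI[of _ 1])
  then show ?thesis using m by (simp add: field_simps power2_eq_square)
qed

section \<open>The largest displacement from the starting point\<close>

lemma norm_add_sq_components:
  fixes y v :: "real ^ 'n"
  shows "(norm (y + v))\<^sup>2 - (norm y)\<^sup>2 = (\<Sum>i\<in>UNIV. 2 * (y $ i * v $ i) + (v $ i)\<^sup>2)"
proof -
  have "(norm (y + v))\<^sup>2 - (norm y)\<^sup>2 = 2 * (y \<bullet> v) + v \<bullet> v"
    by (simp add: power2_norm_eq_inner inner_add inner_commute)
  then show ?thesis
    by (simp add: inner_vec_def sum.distrib sum_distrib_left power2_eq_square)
qed

context std_brownian_motion_vec
begin

lemma vec_walk_increment: "vec_walk (\<lambda>p. increment h p \<omega>) k = W (real k * h) \<omega> - W 0 \<omega>"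
proof (induction k)
  case (Suc k)
  have "(\<chi> i. increment h (k, i) \<omega>) = W (real (Suc k) * h) \<omega> - W (real k * h) \<omega>"
    by (simp add: increment_def vec_eq_iff)
  then show ?case by (simp add: vec_walk_Suc Suc)
qed simp

lemma component_diff_distributed:
  assumes "0 \<le> s" "s < t"
  shows "distributed M lborel (\<lambda>\<omega>. (W t \<omega> - W s \<omega>) $ i) (normal_density 0 (sqrt (t - s)))"
  using std_brownian_motion.normal_increments[OF coordinates assms] by simp

lemma displacement_measurable:
  assumes "0 \<le> s" "0 \<le> t"
  shows "(\<lambda>\<omega>. norm (W t \<omega> - W s \<omega>)) \<in> borel_measurable M"
  using W_measurable[OF assms(1)] W_measurable[OF assms(2)] by measurable

lemma displacement_sq_integrable:
  assumes "0 \<le> s" "s < t"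
  shows "integrable M (\<lambda>\<omega>. (norm (W t \<omega> - W s \<omega>))\<^sup>2)"
proof -
  have "integrable M (\<lambda>\<omega>. \<Sum>i\<in>UNIV. ((W t \<omega> - W s \<omega>) $ i)\<^sup>2)"
    using assms by (intro Bochner_Integration.integrable_sum
        normal_power_integrable[OF component_diff_distributed]) auto
  then show ?thesis by (simp only: norm_vec_def L2_set_def real_sqrt_pow2 sum_nonneg zero_le_power2 real_norm_def power2_abs)
qed

lemma displacement_integrable:
  assumes "0 \<le> s" "s \<le> t"
  shows "integrable M (\<lambda>\<omega>. norm (W t \<omega> - W s \<omega>))"
proof (cases "s = t")
  case False
  then have "integrable M (\<lambda>\<omega>. 1 + (norm (W t \<omega> - W s \<omega>))\<^sup>2)"
    using assms displacement_sq_integrable[of s t] by auto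
  then show ?thesis
  proof (rule Bochner_Integration.integrable_bound)
    have "x \<le> 1 + x\<^sup>2" for x :: real
      using zero_le_power2[of "x - 1 / 2"] by (simp add: power2_eq_square algebra_simps)
    then show "AE \<omega> in M. norm (norm (W t \<omega> - W s \<omega>)) \<le> norm (1 + (norm (W t \<omega> - W s \<omega>))\<^sup>2)"
      by simp
  qed (use assms in \<open>auto intro: displacement_measurable\<close>)
qed simp

lemma max_displacement_integrable:
  assumes h: "0 < h"
  shows "integrable M (\<lambda>\<omega>. run_max (\<lambda>j. norm (W (real j * h) \<omega> - W 0 \<omega>)) k)"
proof (rule Bochner_Integration.integrable_bound)
  show "integrable M (\<lambda>\<omega>. \<Sum>j\<le>k. norm (W (real j * h) \<omega> - W 0 \<omega>))"
    using h by (intro Bochner_Integration.integrable_sum displacement_integrable) auto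
  show "AE \<omega> in M. norm (run_max (\<lambda>j. norm (W (real j * h) \<omega> - W 0 \<omega>)) k)
      \<le> norm (\<Sum>j\<le>k. norm (W (real j * h) \<omega> - W 0 \<omega>))"
  proof (intro AE_I2)
    fix \<omega>
    let ?x = "\<lambda>j. norm (W (real j * h) \<omega> - W 0 \<omega>)"
    have "0 \<le> run_max ?x k" using run_bounds(2)[of 0 k ?x] by simp
    moreover have "run_max ?x k \<le> (\<Sum>j\<le>k. ?x j)"
      unfolding run_max_le_iff by (auto intro: member_le_sum)
    ultimately show "norm (run_max ?x k) \<le> norm (\<Sum>j\<le>k. ?x j)" by simp
  qed
  show "(\<lambda>\<omega>. run_max (\<lambda>j. norm (W (real j * h) \<omega> - W 0 \<omega>)) k) \<in> borel_measurable M"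
    using h by (intro run_max_measurable displacement_measurable) auto
qed

definition mean_max :: "nat \<Rightarrow> real" where
  "mean_max k = expectation (\<lambda>\<omega>. run_max (\<lambda>j. norm (W (real j) \<omega> - W 0 \<omega>)) k)"

text \<open>
The walk with time step \<open>h\<close> has the law of the unit walk multiplied by \<open>sqrt h\<close>.
\<close>

lemma mean_max_scaling:
  assumes h: "0 < h"
  shows "expectation (\<lambda>\<omega>. run_max (\<lambda>j. norm (W (real j * h) \<omega> - W 0 \<omega>)) k) = sqrt h * mean_max k"
proof -
  let ?I = "{..<k} \<times> (UNIV :: 'n set)"
  define f :: "(nat \<times> 'n \<Rightarrow> real) \<Rightarrow> real" where "f = (\<lambda>z. run_max (\<lambda>j. norm (vec_walk z j)) k)"
  have f: "f (\<lambda>p\<in>?I. z p) = run_max (\<lambda>j. norm (vec_walk z j)) k" for z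
    unfolding f_def by (simp add: vec_walk_restrict cong: run_cong)
  have "expectation (\<lambda>\<omega>. f (\<lambda>p\<in>?I. increment h p \<omega>)) = expectation (\<lambda>\<omega>. f (\<lambda>p\<in>?I. sqrt h * increment 1 p \<omega>))"
  proof (rule iid_normal_transfer)
    show "iid_normal (sqrt h) ?I (increment h)" by (rule iid_normal_increment[OF h])
    show "iid_normal (sqrt h) ?I (\<lambda>p \<omega>. sqrt h * increment 1 p \<omega>)"
      using iid_normal_scale[OF iid_normal_increment[of 1 k], of "sqrt h"] h by simp
    show "f \<in> borel_measurable (\<Pi>\<^sub>M p\<in>?I. borel)"
      unfolding f_def by (intro run_max_measurable vec_walk_norm_measurable)
  qed
  moreover have "f (\<lambda>p\<in>?I. sqrt h * increment 1 p \<omega>)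
      = sqrt h * run_max (\<lambda>j. norm (W (real j) \<omega> - W 0 \<omega>)) k" for \<omega>
    unfolding f using h by (simp add: vec_walk_scale vec_walk_increment run_max_cmult)
  ultimately show ?thesis
    by (simp add: f vec_walk_increment mean_max_def)
qed

text \<open>
The squared distance from the starting point grows by \<open>n\<close> per unit of time on average, even when the
increment is weighted by a functional of the past: in each coordinate the term linear in the new
increment has mean zero and the quadratic one has mean one.
\<close>

lemma drift_identity:
  assumes s: "0 < s"
  defines "S \<equiv> \<lambda>\<omega>. floored_max s (\<lambda>j. norm (W (real j) \<omega> - W 0 \<omega>))"
  shows "integrable M (\<lambda>\<omega>. ((norm (W (real (Suc k)) \<omega> - W 0 \<omega>))\<^sup>2 - (norm (W (real k) \<omega> - W 0 \<omega>))\<^sup>2) / S \<omega> k)"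
      (is "integrable M ?D")
    and "expectation (\<lambda>\<omega>. ((norm (W (real (Suc k)) \<omega> - W 0 \<omega>))\<^sup>2 - (norm (W (real k) \<omega> - W 0 \<omega>))\<^sup>2) / S \<omega> k)
      = real CARD('n) * expectation (\<lambda>\<omega>. 1 / S \<omega> k)"
    and "integrable M (\<lambda>\<omega>. 1 / S \<omega> k)"
proof -
  let ?K = "{..<k} \<times> (UNIV :: 'n set)" and ?I = "{..<Suc k} \<times> (UNIV :: 'n set)"
  define Y where "Y = (\<lambda>\<omega>. W (real k) \<omega> - W 0 \<omega>)"
  have Z: "iid_normal 1 ?I (increment 1)"
    using iid_normal_increment[of 1 "Suc k"] by simp
  have N: "distributed M lborel (increment 1 (k, i)) (normal_density 0 1)" for i
    using Z by (auto simp: iid_normal_def)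
  have S_s: "s \<le> S \<omega> k" for \<omega> unfolding S_def by (rule floored_max_ge)
  have S_pos: "0 < S \<omega> k" for \<omega> using S_s[of \<omega>] s by simp
  have S_meas [measurable]: "(\<lambda>\<omega>. S \<omega> k) \<in> borel_measurable M"
    unfolding S_def floored_max_def
    by (intro borel_measurable_max run_max_measurable displacement_measurable) auto
  have Y_meas [measurable]: "(\<lambda>\<omega>. Y \<omega> $ i) \<in> borel_measurable M" for i
    unfolding Y_def vector_minus_component by (intro borel_measurable_diff coordinate_measurable) auto
  show inv_int: "integrable M (\<lambda>\<omega>. 1 / S \<omega> k)"
    using s S_s S_pos
    by (intro integrable_const_bound[where B="1 / s"] AE_I2) (auto simp: frac_le abs_of_pos)
  have dir_int: "integrable M (\<lambda>\<omega>. Y \<omega> $ i / S \<omega> k)" for i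
  proof (intro integrable_const_bound[where B=1] AE_I2)
    fix \<omega>
    have "\<bar>Y \<omega> $ i\<bar> \<le> norm (Y \<omega>)" by (rule component_le_norm_cart)
    also have "\<dots> \<le> S \<omega> k" unfolding S_def Y_def by (rule floored_max_ge) simp
    finally show "norm (Y \<omega> $ i / S \<omega> k) \<le> 1" using S_pos[of \<omega>] by simp
  qed measurable
  define T where "T = (\<lambda>z :: nat \<times> 'n \<Rightarrow> real. floored_max s (\<lambda>j. norm (vec_walk z j)) k)"
  have T_meas [measurable]: "T \<in> borel_measurable (\<Pi>\<^sub>M p\<in>?K. borel)"
    unfolding T_def floored_max_def
    by (intro borel_measurable_max run_max_measurable vec_walk_norm_measurable) auto
  have v_meas [measurable]: "(\<lambda>z. vec_walk z k $ i) \<in> borel_measurable (\<Pi>\<^sub>M p\<in>?K. borel)" for i :: 'n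
    unfolding vec_walk_def by simp
  have T: "T (\<lambda>p\<in>?K. increment 1 p \<omega>) = S \<omega> k"
    and v: "vec_walk (\<lambda>p\<in>?K. increment 1 p \<omega>) k = Y \<omega>" for \<omega>
    unfolding T_def S_def Y_def floored_max_def
    by (simp_all add: vec_walk_restrict vec_walk_increment cong: run_cong)
  have K: "?K \<subseteq> ?I" "(k, i) \<in> ?I" "(k, i) \<notin> ?K" for i :: 'n by auto
  have first: "integrable M (\<lambda>\<omega>. Y \<omega> $ i / S \<omega> k * increment 1 (k, i) \<omega>) \<and>
      expectation (\<lambda>\<omega>. Y \<omega> $ i / S \<omega> k * increment 1 (k, i) \<omega>) = 0" for i
  proof -
    have f: "(\<lambda>z. vec_walk z k $ i / T z) \<in> borel_measurable (\<Pi>\<^sub>M p\<in>?K. borel)" by measurable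
    have g: "(\<lambda>x :: real. x) \<in> borel_measurable borel" by simp
    have 1: "integrable M (\<lambda>\<omega>. increment 1 (k, i) \<omega>)"
      using normal_power_integrable[OF N, where k=1] by simp
    have "expectation (increment 1 (k, i)) = 0"
      by (rule normal_distributed_expectation[OF _ N]) simp
    then show ?thesis
      using iid_normal_past_times_present[OF Z K f g, unfolded T v, OF dir_int 1] by simp
  qed
  have second: "integrable M (\<lambda>\<omega>. 1 / S \<omega> k * (increment 1 (k, i) \<omega>)\<^sup>2) \<and>
      expectation (\<lambda>\<omega>. 1 / S \<omega> k * (increment 1 (k, i) \<omega>)\<^sup>2) = expectation (\<lambda>\<omega>. 1 / S \<omega> k)" for i
  proof -
    have f: "(\<lambda>z. 1 / T z) \<in> borel_measurable (\<Pi>\<^sub>M p\<in>?K. borel)" by measurable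
    have g: "(\<lambda>x :: real. x\<^sup>2) \<in> borel_measurable borel" by simp
    have 2: "integrable M (\<lambda>\<omega>. (increment 1 (k, i) \<omega>)\<^sup>2)"
      by (rule normal_power_integrable[OF N]) simp
    have "expectation (\<lambda>\<omega>. (increment 1 (k, i) \<omega>)\<^sup>2) = 1"
      using normal_second_moment[OF N] by simp
    then show ?thesis
      using iid_normal_past_times_present[OF Z K f g, unfolded T, OF inv_int 2] by simp
  qed
  have D: "?D \<omega> = (\<Sum>i\<in>UNIV. 2 * (Y \<omega> $ i / S \<omega> k * increment 1 (k, i) \<omega>) + 1 / S \<omega> k * (increment 1 (k, i) \<omega>)\<^sup>2)" for \<omega>
  proof -
    have "W (real (Suc k)) \<omega> - W 0 \<omega> = Y \<omega> + (\<chi> i. increment 1 (k, i) \<omega>)"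
      by (simp add: Y_def increment_def vec_eq_iff)
    then have "?D \<omega> = ((norm (Y \<omega> + (\<chi> i. increment 1 (k, i) \<omega>)))\<^sup>2 - (norm (Y \<omega>))\<^sup>2) / S \<omega> k"
      by (simp only: Y_def)
    then show ?thesis
      unfolding norm_add_sq_components by (simp add: sum_divide_distrib add_divide_distrib)
  qed
  show "integrable M ?D"
    unfolding D using first second
    by (intro Bochner_Integration.integrable_sum Bochner_Integration.integrable_add integrable_mult_right) blast+
  show "expectation ?D = real CARD('n) * expectation (\<lambda>\<omega>. 1 / S \<omega> k)"
  proof -
    have "expectation (\<lambda>\<omega>. 2 * (Y \<omega> $ i / S \<omega> k * increment 1 (k, i) \<omega>) + 1 / S \<omega> k * (increment 1 (k, i) \<omega>)\<^sup>2)
        = 2 * expectation (\<lambda>\<omega>. Y \<omega> $ i / S \<omega> k * increment 1 (k, i) \<omega>)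
          + expectation (\<lambda>\<omega>. 1 / S \<omega> k * (increment 1 (k, i) \<omega>)\<^sup>2)" for i
      by (subst Bochner_Integration.integral_add)
         (simp_all only: first second integrable_mult_right integral_mult_right_zero)
    then have "expectation (\<lambda>\<omega>. 2 * (Y \<omega> $ i / S \<omega> k * increment 1 (k, i) \<omega>) + 1 / S \<omega> k * (increment 1 (k, i) \<omega>)\<^sup>2)
        = expectation (\<lambda>\<omega>. 1 / S \<omega> k)" for i
      by (simp only: first second)
    then show ?thesis
      unfolding D
      by (subst Bochner_Integration.integral_sum)
         (use first second in \<open>simp_all only: integrable_mult_right Bochner_Integration.integrable_add sum_constant\<close>)
  qed
qed

text \<open>
The bound has to be uniform in the time, since it is summed over all steps.
\<close>

lemma step_fourth_moment:
  obtains C where "\<And>k. integrable M (\<lambda>\<omega>. norm (W (real (Suc k)) \<omega> - W (real k) \<omega>) ^ 4)"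
    and "\<And>k. expectation (\<lambda>\<omega>. norm (W (real (Suc k)) \<omega> - W (real k) \<omega>) ^ 4) \<le> C"
proof
  define c where "c = (\<integral>x. normal_density 0 1 x * x ^ 4 \<partial>lborel)"
  fix k
  let ?v = "\<lambda>\<omega>. W (real (Suc k)) \<omega> - W (real k) \<omega>"
  have N: "distributed M lborel (\<lambda>\<omega>. ?v \<omega> $ i) (normal_density 0 1)" for i
    using component_diff_distributed[of "real k" "real (Suc k)" i] by simp
  have i4: "integrable M (\<lambda>\<omega>. (?v \<omega> $ i) ^ 4)" for i
    by (rule normal_power_integrable[OF N]) simp
  have e4: "expectation (\<lambda>\<omega>. (?v \<omega> $ i) ^ 4) = c" for i
    unfolding c_def by (subst distributed_integral[OF N[of i], symmetric]) auto
  have le: "norm (?v \<omega>) ^ 4 \<le> real CARD('n) * (\<Sum>i\<in>UNIV. (?v \<omega> $ i) ^ 4)" for \<omega>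
  proof -
    have "norm (?v \<omega>) ^ 4 = ((norm (?v \<omega>))\<^sup>2)\<^sup>2" by simp
    also have "(norm (?v \<omega>))\<^sup>2 = (\<Sum>i\<in>UNIV. (?v \<omega> $ i)\<^sup>2)"
      unfolding power2_norm_eq_inner inner_vec_def by (simp add: power2_eq_square)
    also have "(\<Sum>i\<in>UNIV. (?v \<omega> $ i)\<^sup>2)\<^sup>2 \<le> real CARD('n) * (\<Sum>i\<in>UNIV. ((?v \<omega> $ i)\<^sup>2)\<^sup>2)"
      using sum_squared_le_sum_of_squares[of "\<lambda>i. (?v \<omega> $ i)\<^sup>2" UNIV] by (simp add: mult.commute)
    finally show ?thesis by simp
  qed
  have dom: "integrable M (\<lambda>\<omega>. real CARD('n) * (\<Sum>i\<in>UNIV. (?v \<omega> $ i) ^ 4))"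
    using i4 by auto
  show int: "integrable M (\<lambda>\<omega>. norm (?v \<omega>) ^ 4)"
  proof (rule Bochner_Integration.integrable_bound[OF dom])
    show "AE \<omega> in M. norm (norm (?v \<omega>) ^ 4) \<le> norm (real CARD('n) * (\<Sum>i\<in>UNIV. (?v \<omega> $ i) ^ 4))"
      using le by (intro AE_I2) (smt (verit) real_norm_def norm_ge_zero zero_le_power)
    show "(\<lambda>\<omega>. norm (?v \<omega>) ^ 4) \<in> borel_measurable M"
      by (intro borel_measurable_power displacement_measurable) auto
  qed
  have "expectation (\<lambda>\<omega>. norm (?v \<omega>) ^ 4) \<le> expectation (\<lambda>\<omega>. real CARD('n) * (\<Sum>i\<in>UNIV. (?v \<omega> $ i) ^ 4))"
    by (intro integral_mono int dom le)
  also have "\<dots> = (real CARD('n))\<^sup>2 * c"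
    using i4 e4 by (simp add: Bochner_Integration.integral_sum power2_eq_square)
  finally show "expectation (\<lambda>\<omega>. norm (?v \<omega>) ^ 4) \<le> (real CARD('n))\<^sup>2 * c" .
qed

text \<open>
Weight the growth of the squared distance by the reciprocal of the running maximum \<open>S\<close>. Summed up to time
\<open>N\<close> this has mean \<open>n\<close> times the sum of the means of \<open>1 / S k\<close>, which by convexity are at least about
\<open>1 / (m * sqrt k)\<close>, so that it is at least about \<open>2 * n * sqrt N / m\<close>. Pathwise the weighted sum is at most
about \<open>2 * S N\<close>, whose mean is at most \<open>2 * m * sqrt N\<close>.
\<close>

lemma mean_max_growth:
  assumes m: "0 < m" and bound: "\<And>k. mean_max k \<le> m * sqrt (real k)"
  shows "sqrt (real CARD('n)) \<le> m"
proof -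
  obtain C where C: "\<And>k. integrable M (\<lambda>\<omega>. norm (W (real (Suc k)) \<omega> - W (real k) \<omega>) ^ 4)"
    "\<And>k. expectation (\<lambda>\<omega>. norm (W (real (Suc k)) \<omega> - W (real k) \<omega>) ^ 4) \<le> C"
    by (rule step_fourth_moment) blast
  let ?n = "real CARD('n)"
  have "?n \<le> m\<^sup>2"
  proof (rule sqrt_growth_constant_bound[OF m])
    fix N :: nat and s L :: real assume s: "0 < s" and L: "0 < L"
    define x where "x = (\<lambda>\<omega> j. norm (W (real j) \<omega> - W 0 \<omega>))"
    define S where "S = (\<lambda>\<omega>. floored_max s (x \<omega>))"
    define d where "d = (\<lambda>\<omega> k. norm (W (real (Suc k)) \<omega> - W (real k) \<omega>))"
    have drift: "integrable M (\<lambda>\<omega>. ((x \<omega> (Suc k))\<^sup>2 - (x \<omega> k)\<^sup>2) / S \<omega> k)"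
      "expectation (\<lambda>\<omega>. ((x \<omega> (Suc k))\<^sup>2 - (x \<omega> k)\<^sup>2) / S \<omega> k) = ?n * expectation (\<lambda>\<omega>. 1 / S \<omega> k)"
      "integrable M (\<lambda>\<omega>. 1 / S \<omega> k)" for k
      unfolding S_def x_def by (rule drift_identity[OF s])+
    have x_nonneg: "0 \<le> x \<omega> k" for \<omega> k by (simp add: x_def)
    have R_int: "integrable M (\<lambda>\<omega>. run_max (x \<omega>) k)" for k
      using max_displacement_integrable[of 1 k] by (simp add: x_def)
    have S_pos: "0 < S \<omega> k" for \<omega> k
      using s floored_max_ge(1)[of s "x \<omega>" k] by (simp add: S_def)
    have S_le: "S \<omega> k \<le> s + run_max (x \<omega>) k" for \<omega> k
      using s run_bounds(2)[of 0 k "x \<omega>"] x_nonneg[of \<omega> 0] by (simp add: S_def floored_max_def)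
    have S_int: "integrable M (\<lambda>\<omega>. S \<omega> k)" for k
      unfolding S_def floored_max_def using R_int by (intro integrable_max) auto
    have ES: "expectation (\<lambda>\<omega>. S \<omega> k) \<le> s + m * sqrt (real k)" for k
    proof -
      have "expectation (\<lambda>\<omega>. S \<omega> k) \<le> expectation (\<lambda>\<omega>. s + run_max (x \<omega>) k)"
        using R_int S_le by (intro integral_mono S_int) auto
      also have "\<dots> = s + mean_max k"
        using R_int by (simp add: mean_max_def x_def prob_space)
      finally show ?thesis using bound[of k] by simp
    qed
    have inv: "1 / (m * sqrt (real k)) - s / (m\<^sup>2 * real k) \<le> expectation (\<lambda>\<omega>. 1 / S \<omega> k)" if "0 < k" for k
    proof -
      define c where "c = m * sqrt (real k)"
      have c: "0 < c" using m that by (simp add: c_def)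
      \<comment> \<open>The tangent of the convex function 1/y at c.\<close>
      have tangent: "2 / c - y / c\<^sup>2 \<le> 1 / y" if "0 < y" for y :: real
      proof -
        have "1 / y - (2 / c - y / c\<^sup>2) = (c - y)\<^sup>2 / (y * c\<^sup>2)"
          using c that by (simp add: field_simps power2_eq_square)
        then show ?thesis using that c by (smt (verit) divide_nonneg_nonneg zero_le_power2 mult_nonneg_nonneg)
      qed
      have "1 / c - s / c\<^sup>2 = 2 / c - (s + c) / c\<^sup>2"
        using c by (simp add: field_simps power2_eq_square)
      also have "\<dots> \<le> 2 / c - expectation (\<lambda>\<omega>. S \<omega> k) / c\<^sup>2"
        using ES[of k] by (intro diff_left_mono divide_right_mono) (auto simp: c_def)
      also have "\<dots> = expectation (\<lambda>\<omega>. 2 / c - S \<omega> k / c\<^sup>2)"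
        using S_int by (simp add: prob_space)
      also have "\<dots> \<le> expectation (\<lambda>\<omega>. 1 / S \<omega> k)"
        using S_int drift(3) S_pos by (intro integral_mono tangent) auto
      finally show ?thesis by (simp add: c_def power_mult_distrib)
    qed
    have "?n * (\<Sum>k=1..N. 1 / (m * sqrt (real k)) - s / (m\<^sup>2 * real k))
        \<le> ?n * (\<Sum>k=1..N. expectation (\<lambda>\<omega>. 1 / S \<omega> k))"
      by (intro mult_left_mono sum_mono inv) auto
    also have "\<dots> \<le> ?n * (\<Sum>k<Suc N. expectation (\<lambda>\<omega>. 1 / S \<omega> k))"
      using S_pos by (intro mult_left_mono sum_mono2 integral_nonneg_AE AE_I2) (auto intro: less_imp_le)
    also have "\<dots> = expectation (\<lambda>\<omega>. \<Sum>k<Suc N. ((x \<omega> (Suc k))\<^sup>2 - (x \<omega> k)\<^sup>2) / S \<omega> k)"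
      using drift(1,2)
      by (subst Bochner_Integration.integral_sum) (simp_all add: sum_distrib_left del: sum.lessThan_Suc)
    also have "\<dots> \<le> expectation (\<lambda>\<omega>. (2 + L / s) * S \<omega> (Suc N) + (\<Sum>k<Suc N. d \<omega> k ^ 4) / (L\<^sup>2 * s))"
    proof (rule integral_mono)
      show "integrable M (\<lambda>\<omega>. \<Sum>k<Suc N. ((x \<omega> (Suc k))\<^sup>2 - (x \<omega> k)\<^sup>2) / S \<omega> k)"
        using drift(1) by (intro Bochner_Integration.integrable_sum) auto
      show "integrable M (\<lambda>\<omega>. (2 + L / s) * S \<omega> (Suc N) + (\<Sum>k<Suc N. d \<omega> k ^ 4) / (L\<^sup>2 * s))"
        using S_int C(1) unfolding d_def
        by (intro Bochner_Integration.integrable_add integrable_mult_right integrable_divide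
            Bochner_Integration.integrable_sum) auto
      fix \<omega>
      have "x \<omega> (Suc k) \<le> x \<omega> k + d \<omega> k" for k
        using norm_triangle_ineq[of "W (real k) \<omega> - W 0 \<omega>" "W (real (Suc k)) \<omega> - W (real k) \<omega>"]
        by (simp add: x_def d_def)
      then show "(\<Sum>k<Suc N. ((x \<omega> (Suc k))\<^sup>2 - (x \<omega> k)\<^sup>2) / S \<omega> k)
          \<le> (2 + L / s) * S \<omega> (Suc N) + (\<Sum>k<Suc N. d \<omega> k ^ 4) / (L\<^sup>2 * s)"
        unfolding S_def by (intro floored_max_sum s L x_nonneg) (auto simp: d_def)
    qed
    also have "\<dots> = (2 + L / s) * expectation (\<lambda>\<omega>. S \<omega> (Suc N))
        + (\<Sum>k<Suc N. expectation (\<lambda>\<omega>. d \<omega> k ^ 4)) / (L\<^sup>2 * s)"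
    proof -
      have "integrable M (\<lambda>\<omega>. \<Sum>k<Suc N. d \<omega> k ^ 4)"
        using C(1) unfolding d_def by (intro Bochner_Integration.integrable_sum) auto
      moreover have "expectation (\<lambda>\<omega>. \<Sum>k<Suc N. d \<omega> k ^ 4) = (\<Sum>k<Suc N. expectation (\<lambda>\<omega>. d \<omega> k ^ 4))"
        using C(1) unfolding d_def by (intro Bochner_Integration.integral_sum) auto
      ultimately show ?thesis using S_int by (simp del: sum.lessThan_Suc)
    qed
    also have "\<dots> \<le> (2 + L / s) * (s + m * sqrt (real (Suc N))) + (\<Sum>k<Suc N. C) / (L\<^sup>2 * s)"
      using s L C(2) ES[of "Suc N"] unfolding d_def
      by (intro add_mono mult_left_mono divide_right_mono sum_mono) auto
    finally show "?n * (\<Sum>k=1..N. 1 / (m * sqrt (real k)) - s / (m\<^sup>2 * real k))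
        \<le> (2 + L / s) * (s + m * sqrt (real (Suc N))) + C * real (Suc N) / (L\<^sup>2 * s)"
      by (simp add: mult.commute)
  qed simp
  then show ?thesis using m by (simp add: real_le_lsqrt)
qed

end

section \<open>The diameter along grids and along the path\<close>

text \<open>
A ball of radius \<open>c\<close> around a point is convex. Hence the bound passes to the hull in one argument and then
in the other, and the convex hull has the same diameter as the set.
\<close>

lemma convex_hull_dist_le:
  fixes P :: "'b :: real_normed_vector set"
  assumes "\<And>x y. x \<in> P \<Longrightarrow> y \<in> P \<Longrightarrow> dist x y \<le> c" "x \<in> convex hull P" "y \<in> convex hull P"
  shows "dist x y \<le> c"
proof -
  have "convex hull P \<subseteq> cball p c" if "p \<in> P" for p
    using assms(1) that by (intro hull_minimal) auto
  then have "x \<in> cball p c" if "p \<in> P" for p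
    using assms(2) that by blast
  then have "P \<subseteq> cball x c"
    by (auto simp: dist_commute)
  then have "convex hull P \<subseteq> cball x c"
    by (intro hull_minimal) auto
  then show ?thesis using assms(3) by auto
qed

lemma measurable_completion_AE_eq:
  fixes f g :: "'b \<Rightarrow> real"
  assumes g: "g \<in> borel_measurable M" and ae: "AE x in M. f x = g x"
  shows "f \<in> borel_measurable (completion M)"
proof (rule measurableI)
  fix A :: "real set" assume A: "A \<in> sets borel"
  show "f -` A \<inter> space (completion M) \<in> sets (completion M)"
  proof (rule completion.in_sets_AE)
    show "g -` A \<inter> space M \<in> sets (completion M)"
      using measurable_sets[OF g A] by simp
    have "AE x in M. x \<in> g -` A \<inter> space M \<longleftrightarrow> x \<in> f -` A \<inter> space (completion M)"
      using ae by eventually_elim auto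
    then show "AE x in completion M. x \<in> g -` A \<inter> space M \<longleftrightarrow> x \<in> f -` A \<inter> space (completion M)"
      by (rule AE_completion)
  qed auto
qed auto

definition grid_diameter :: "(real \<Rightarrow> 'b :: metric_space) \<Rightarrow> nat \<Rightarrow> real" where
  "grid_diameter p k = run_max (\<lambda>i. run_max (\<lambda>j. dist (p (real i * (1 / real k))) (p (real j * (1 / real k)))) k) k"

lemma grid_diameter_le_iff:
  "grid_diameter p k \<le> c \<longleftrightarrow> (\<forall>i\<le>k. \<forall>j\<le>k. dist (p (real i * (1 / real k))) (p (real j * (1 / real k))) \<le> c)"
  by (simp add: grid_diameter_def run_max_le_iff)

lemma grid_diameter_nonneg: "0 \<le> grid_diameter p k"
proof -
  have "dist (p (real 0 * (1 / real k))) (p (real 0 * (1 / real k))) \<le> grid_diameter p k"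
    using grid_diameter_le_iff[of p k "grid_diameter p k"] by blast
  then show ?thesis by simp
qed

lemma path_hull_dist_le:
  assumes "continuous_on {0..1} p" "s \<in> {0..1}" "t \<in> {0..1 :: real}"
  shows "dist (p s) (p t) \<le> diameter (convex hull (p ` {0..1}) :: 'b :: real_normed_vector set)"
  using assms
  by (intro diameter_bounded_bound bounded_convex_hull compact_imp_bounded compact_continuous_image)
     (auto intro!: hull_inc)

text \<open>
The diameter is the supremum of the distances between path points, and each path point is the limit of
its neighbours on the grids.
\<close>

lemma grid_diameter_tendsto:
  fixes p :: "real \<Rightarrow> 'b :: real_normed_vector"
  assumes p: "continuous_on {0..1} p"
  shows "(\<lambda>k. grid_diameter p (Suc k)) \<longlonglongrightarrow> diameter (convex hull (p ` {0..1}))"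
proof (rule order_tendstoI)
  let ?D = "diameter (convex hull (p ` {0..1}))"
  have le: "grid_diameter p (Suc k) \<le> ?D" for k
    unfolding grid_diameter_le_iff by (intro allI impI path_hull_dist_le p) auto
  fix a assume "?D < a"
  then show "\<forall>\<^sub>F k in sequentially. grid_diameter p (Suc k) < a"
    by (intro always_eventually allI le_less_trans[OF le])
next
  let ?D = "diameter (convex hull (p ` {0..1}))"
  fix a assume a: "a < ?D"
  obtain s t where st: "s \<in> {0..1}" "t \<in> {0..1}" "a < dist (p s) (p t)"
  proof (rule ccontr)
    assume "\<not> thesis"
    with that have "dist x y \<le> a" if "x \<in> p ` {0..1}" "y \<in> p ` {0..1}" for x y
      using \<open>x \<in> p ` {0..1}\<close> \<open>y \<in> p ` {0..1}\<close> by force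
    then have "?D \<le> a"
      by (intro diameter_le) (auto intro: convex_hull_dist_le[unfolded dist_norm] simp: dist_norm)
    with a show False by simp
  qed
  \<comment> \<open>The last point of the grid of mesh 1 / Suc k that does not exceed x.\<close>
  define r where "r = (\<lambda>x k. real (nat \<lfloor>x * real (Suc k)\<rfloor>) * (1 / real (Suc k)))"
  have r: "r x k \<in> {0..1}" "nat \<lfloor>x * real (Suc k)\<rfloor> \<le> Suc k" if "x \<in> {0..1}" for x k
  proof -
    have "x * real (Suc k) \<le> 1 * real (Suc k)" using that by (intro mult_right_mono) auto
    from floor_mono[OF this] have "\<lfloor>x * real (Suc k)\<rfloor> \<le> int (Suc k)"
      by (simp only: mult_1 floor_of_nat)
    then show "nat \<lfloor>x * real (Suc k)\<rfloor> \<le> Suc k" by simp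
    then have "real (nat \<lfloor>x * real (Suc k)\<rfloor>) \<le> real (Suc k)" by (simp only: of_nat_le_iff)
    then show "r x k \<in> {0..1}" by (simp add: r_def)
  qed
  have r_lim: "(\<lambda>k. r x k) \<longlonglongrightarrow> x" if x: "x \<in> {0..1}" for x
  proof (rule LIM_zero_cancel, rule Lim_null_comparison)
    show "(\<lambda>k. inverse (real (Suc k))) \<longlonglongrightarrow> 0" by (rule LIMSEQ_inverse_real_of_nat)
    show "\<forall>\<^sub>F k in sequentially. norm (r x k - x) \<le> inverse (real (Suc k))"
    proof (intro always_eventually allI)
      fix k
      have "real (nat \<lfloor>x * real (Suc k)\<rfloor>) = of_int \<lfloor>x * real (Suc k)\<rfloor>"
        using x by simp
      then have "r x k - x = (of_int \<lfloor>x * real (Suc k)\<rfloor> - x * real (Suc k)) * inverse (real (Suc k))"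
        by (simp add: r_def left_diff_distrib divide_inverse mult.assoc del: of_nat_Suc)
      moreover have "\<bar>of_int \<lfloor>x * real (Suc k)\<rfloor> - x * real (Suc k)\<bar> \<le> 1"
        by linarith
      then have "\<bar>of_int \<lfloor>x * real (Suc k)\<rfloor> - x * real (Suc k)\<bar> * inverse (real (Suc k)) \<le> 1 * inverse (real (Suc k))"
        by (intro mult_right_mono) auto
      ultimately show "norm (r x k - x) \<le> inverse (real (Suc k))"
        by (simp add: abs_mult del: of_nat_Suc)
    qed
  qed
  have "(\<lambda>k. p (r x k)) \<longlonglongrightarrow> p x" if x: "x \<in> {0..1}" for x
    using continuous_on_tendsto_compose[OF p r_lim[OF x] x] r(1)[OF x] by auto
  then have "(\<lambda>k. dist (p (r s k)) (p (r t k))) \<longlonglongrightarrow> dist (p s) (p t)"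
    using st by (intro tendsto_dist) auto
  then have "\<forall>\<^sub>F k in sequentially. a < dist (p (r s k)) (p (r t k))"
    using st(3) by (rule order_tendstoD)
  then show "\<forall>\<^sub>F k in sequentially. a < grid_diameter p (Suc k)"
  proof eventually_elim
    case (elim k)
    have "dist (p (r s k)) (p (r t k)) \<le> grid_diameter p (Suc k)"
      using grid_diameter_le_iff[of p "Suc k" "grid_diameter p (Suc k)"] r(2) st(1,2)
      unfolding r_def by blast
    with elim show ?case by simp
  qed
qed

context std_brownian_motion_vec
begin

lemma AE_continuous: "AE \<omega> in M. continuous_on {0..} (\<lambda>t. W t \<omega>)"
proof -
  have "AE \<omega> in M. \<forall>i. continuous_on {0..} (\<lambda>t. W t \<omega> $ i)"
    unfolding AE_all_countable using std_brownian_motion.continuous_paths[OF coordinates] by blast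
  then show ?thesis
  proof eventually_elim
    case (elim \<omega>)
    then have "continuous_on {0..} (\<lambda>t. \<chi> i. W t \<omega> $ i)" by (intro continuous_on_vec_lambda) auto
    then show ?case by (simp add: vec_nth_inverse)
  qed
qed

lemma grid_diameter_measurable: "(\<lambda>\<omega>. grid_diameter (\<lambda>t. W t \<omega>) k) \<in> borel_measurable M"
  unfolding grid_diameter_def dist_norm
  by (intro run_max_measurable displacement_measurable) auto

lemma grid_diameter_sq_le:
  "(grid_diameter (\<lambda>t. W t \<omega>) k)\<^sup>2 \<le> (\<Sum>i\<in>UNIV. (run_range (\<lambda>j. W (real j * (1 / real k)) \<omega> $ i) k)\<^sup>2)"
  (is "_ \<le> ?R")
proof -
  have "0 \<le> ?R" by (intro sum_nonneg) auto
  have "dist (W (real a * (1 / real k)) \<omega>) (W (real b * (1 / real k)) \<omega>) \<le> sqrt ?R"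
    if "a \<le> k" "b \<le> k" for a b
    unfolding dist_vec_def L2_set_def dist_real_def using that
    by (intro real_sqrt_le_mono sum_mono power_mono dist_le_run_range) auto
  then have "grid_diameter (\<lambda>t. W t \<omega>) k \<le> sqrt ?R"
    by (simp add: grid_diameter_le_iff)
  then have "(grid_diameter (\<lambda>t. W t \<omega>) k)\<^sup>2 \<le> (sqrt ?R)\<^sup>2"
    by (intro power_mono grid_diameter_nonneg)
  with \<open>0 \<le> ?R\<close> show ?thesis by simp
qed

text \<open>
The squared diameter is at most the sum of the squared ranges of the coordinates, whose means are at most
\<open>4 * ln 2\<close>. The inequality \<open>g \<le> (g\<^sup>2 / c + c) / 2\<close> turns the resulting bound \<open>c\<^sup>2\<close> for the mean square
into the bound \<open>c\<close> for the mean.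
\<close>

lemma grid_diameter_mean_le:
  assumes k: "0 < k"
  shows "integrable M (\<lambda>\<omega>. grid_diameter (\<lambda>t. W t \<omega>) k)"
    and "expectation (\<lambda>\<omega>. grid_diameter (\<lambda>t. W t \<omega>) k) \<le> 2 * sqrt (ln 2) * sqrt (real CARD('n))"
proof -
  define c where "c = 2 * sqrt (ln 2) * sqrt (real CARD('n))"
  have c: "0 < c" "c\<^sup>2 = 4 * ln 2 * real CARD('n)" by (simp_all add: c_def power_mult_distrib)
  let ?G = "\<lambda>\<omega>. grid_diameter (\<lambda>t. W t \<omega>) k"
  let ?R = "\<lambda>i \<omega>. (run_range (\<lambda>j. W (real j * (1 / real k)) \<omega> $ i) k)\<^sup>2"
  have R: "integrable M (?R i)" for i
    by (rule std_brownian_motion.mesh_range_sq_integrable[OF coordinates]) (use k in simp)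
  have ER: "expectation (?R i) \<le> 4 * ln 2" for i
  proof -
    have "expectation (?R i) = 1 / real k * std_brownian_motion.mean_sq_range M (\<lambda>t \<omega>. W t \<omega> $ i) k"
      by (rule std_brownian_motion.mean_sq_range_scaling[OF coordinates]) (use k in simp)
    also have "\<dots> \<le> 1 / real k * (4 * ln 2 * real k)"
      by (intro mult_left_mono std_brownian_motion.mean_sq_range_le[OF coordinates]) auto
    finally show ?thesis using k by simp
  qed
  have le: "?G \<omega> \<le> ((\<Sum>i\<in>UNIV. ?R i \<omega>) / c + c) / 2" for \<omega>
  proof -
    have "2 * c * ?G \<omega> \<le> (?G \<omega>)\<^sup>2 + c\<^sup>2"
      using zero_le_power2[of "?G \<omega> - c"] by (simp add: power2_diff mult_ac)
    also have "\<dots> \<le> (\<Sum>i\<in>UNIV. ?R i \<omega>) + c\<^sup>2"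
      using grid_diameter_sq_le by simp
    finally show ?thesis using c(1) by (simp add: field_simps power2_eq_square)
  qed
  have dom: "integrable M (\<lambda>\<omega>. ((\<Sum>i\<in>UNIV. ?R i \<omega>) / c + c) / 2)"
    using R by auto
  show int: "integrable M ?G"
  proof (rule Bochner_Integration.integrable_bound[OF dom grid_diameter_measurable])
    show "AE \<omega> in M. norm (?G \<omega>) \<le> norm (((\<Sum>i\<in>UNIV. ?R i \<omega>) / c + c) / 2)"
      unfolding real_norm_def abs_of_nonneg[OF grid_diameter_nonneg]
      by (intro AE_I2 order.trans[OF le abs_ge_self])
  qed
  have "expectation ?G \<le> expectation (\<lambda>\<omega>. ((\<Sum>i\<in>UNIV. ?R i \<omega>) / c + c) / 2)"
    by (intro integral_mono int dom le)
  also have "\<dots> = ((\<Sum>i\<in>UNIV. expectation (?R i)) / c + c) / 2"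
    using R by (simp add: Bochner_Integration.integral_sum prob_space)
  also have "\<dots> \<le> ((\<Sum>i\<in>(UNIV :: 'n set). 4 * ln 2) / c + c) / 2"
    using c(1) ER by (intro divide_right_mono add_right_mono sum_mono) auto
  also have "\<dots> = (c\<^sup>2 / c + c) / 2" by (simp add: c(2) mult.commute)
  also have "\<dots> = c" using c(1) by (simp add: power2_eq_square)
  finally show "expectation ?G \<le> 2 * sqrt (ln 2) * sqrt (real CARD('n))" by (simp add: c_def)
qed

text \<open>
The limit of the grid diameters is measurable and agrees with the diameter of the hull wherever the path
is continuous. Fatou's lemma carries the bound on the means to the limit.
\<close>

lemma hull_diameter_measurable_version:
  obtains D where "D \<in> borel_measurable M" "AE \<omega> in M. hull_diameter W 1 \<omega> = D \<omega>" "AE \<omega> in M. 0 \<le> D \<omega>"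
    "integrable M D" "expectation D \<le> 2 * sqrt (ln 2) * sqrt (real CARD('n))"
proof
  define c where "c = 2 * sqrt (ln 2) * sqrt (real CARD('n))"
  let ?G = "\<lambda>k \<omega>. grid_diameter (\<lambda>t. W t \<omega>) (Suc k)"
  define D where "D = (\<lambda>\<omega>. lim (\<lambda>k. ?G k \<omega>))"
  show meas: "D \<in> borel_measurable M"
    unfolding D_def by (intro borel_measurable_lim_metric grid_diameter_measurable)
  have lim: "AE \<omega> in M. (\<lambda>k. ?G k \<omega>) \<longlonglongrightarrow> hull_diameter W 1 \<omega>"
    using AE_continuous
  proof eventually_elim
    case (elim \<omega>)
    then show ?case
      unfolding hull_diameter_def path_hull_def
      by (intro grid_diameter_tendsto) (auto elim: continuous_on_subset)
  qed
  then show eq: "AE \<omega> in M. hull_diameter W 1 \<omega> = D \<omega>"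
    by eventually_elim (simp add: D_def limI)
  show D_nonneg: "AE \<omega> in M. 0 \<le> D \<omega>"
    using lim eq
  proof eventually_elim
    case (elim \<omega>)
    then show ?case
      by (intro LIMSEQ_le_const[of "\<lambda>k. ?G k \<omega>"]) (auto simp: grid_diameter_nonneg)
  qed
  have "(\<integral>\<^sup>+\<omega>. ennreal (D \<omega>) \<partial>M) = (\<integral>\<^sup>+\<omega>. liminf (\<lambda>k. ennreal (?G k \<omega>)) \<partial>M)"
  proof (rule nn_integral_cong_AE)
    show "AE \<omega> in M. ennreal (D \<omega>) = liminf (\<lambda>k. ennreal (?G k \<omega>))"
      using lim eq
    proof eventually_elim
      case (elim \<omega>)
      then have "(\<lambda>k. ennreal (?G k \<omega>)) \<longlonglongrightarrow> ennreal (D \<omega>)"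
        by (intro tendsto_ennrealI) auto
      then show ?case by (simp add: lim_imp_Liminf)
    qed
  qed
  also have "\<dots> \<le> liminf (\<lambda>k. \<integral>\<^sup>+\<omega>. ennreal (?G k \<omega>) \<partial>M)"
    using grid_diameter_measurable by (intro nn_integral_liminf) measurable
  also have "\<dots> \<le> limsup (\<lambda>k. \<integral>\<^sup>+\<omega>. ennreal (?G k \<omega>) \<partial>M)"
    by (rule Liminf_le_Limsup) simp
  also have "\<dots> \<le> ennreal c"
  proof (rule Limsup_bounded, intro always_eventually allI)
    fix k
    have "(\<integral>\<^sup>+\<omega>. ennreal (?G k \<omega>) \<partial>M) = ennreal (expectation (?G k))"
      by (intro nn_integral_eq_integral grid_diameter_mean_le AE_I2 grid_diameter_nonneg) simp
    also have "\<dots> \<le> ennreal c"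
      unfolding c_def by (intro ennreal_leI grid_diameter_mean_le) simp
    finally show "(\<integral>\<^sup>+\<omega>. ennreal (?G k \<omega>) \<partial>M) \<le> ennreal c" .
  qed
  finally have le: "(\<integral>\<^sup>+\<omega>. ennreal (D \<omega>) \<partial>M) \<le> ennreal c" .
  then show int: "integrable M D"
    using meas D_nonneg by (intro integrableI_nonneg) (auto intro: le_less_trans)
  from le have "ennreal (expectation D) \<le> ennreal c"
    using int D_nonneg by (simp add: nn_integral_eq_integral)
  then show "expectation D \<le> 2 * sqrt (ln 2) * sqrt (real CARD('n))"
    by (simp add: c_def)
qed

end

section \<open>The expected diameter\<close>

theorem theorem3:
  fixes M :: "'a measure" and W :: "real \<Rightarrow> 'a \<Rightarrow> real ^ 'n"
  assumes "std_brownian_motion_vec M W"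
  shows "integrable (completion M) (hull_diameter W 1)
    \<and> sqrt (real CARD('n)) \<le> completed_expectation M (hull_diameter W 1)
    \<and> completed_expectation M (hull_diameter W 1) \<le> 2 * sqrt (ln 2) * sqrt (real CARD('n))"
proof -
  interpret std_brownian_motion_vec M W by fact
  obtain D where D: "D \<in> borel_measurable M" "AE \<omega> in M. hull_diameter W 1 \<omega> = D \<omega>"
    "integrable M D" "expectation D \<le> 2 * sqrt (ln 2) * sqrt (real CARD('n))" "AE \<omega> in M. 0 \<le> D \<omega>"
    by (rule hull_diameter_measurable_version)
  note [measurable] = measurable_completion[OF D(1)] measurable_completion_AE_eq[OF D(1,2)]
  have "integrable (completion M) (hull_diameter W 1) \<longleftrightarrow> integrable (completion M) D"
    by (intro integrable_cong_AE AE_completion D(2)) measurable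
  then have int: "integrable (completion M) (hull_diameter W 1)"
    using D(1,3) by (simp add: integrable_completion)
  have "completed_expectation M (hull_diameter W 1) = integral\<^sup>L (completion M) D"
    unfolding completed_expectation_def
    by (intro integral_cong_AE AE_completion D(2)) measurable
  then have eq: "completed_expectation M (hull_diameter W 1) = expectation D"
    using D(1) by (simp add: integral_completion)
  have "0 \<le> expectation D"
    by (rule integral_nonneg_AE[OF D(5)])
  \<comment> \<open>The displacements over the grid of mesh 1 / k are distances inside the hull.\<close>
  have mean_max_le: "mean_max k \<le> expectation D * sqrt (real k)" for k
  proof (cases "k = 0")
    case False
    let ?R = "\<lambda>\<omega>. run_max (\<lambda>j. norm (W (real j * (1 / real k)) \<omega> - W 0 \<omega>)) k"
    have "sqrt (1 / real k) * mean_max k = expectation ?R"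
      using False by (subst mean_max_scaling) auto
    also have "\<dots> \<le> expectation D"
    proof (intro integral_mono_AE max_displacement_integrable D(3))
      show "AE \<omega> in M. ?R \<omega> \<le> D \<omega>"
        using AE_continuous D(2)
      proof eventually_elim
        case (elim \<omega>)
        then have "continuous_on {0..1} (\<lambda>t. W t \<omega>)" by (auto elim: continuous_on_subset)
        from path_hull_dist_le[OF this] have "?R \<omega> \<le> hull_diameter W 1 \<omega>"
          using False unfolding run_max_le_iff hull_diameter_def path_hull_def dist_norm by auto
        with elim show ?case by simp
      qed
    qed (use False in simp)
    finally show ?thesis using False by (simp add: real_sqrt_divide field_simps)
  qed (simp add: mean_max_def)
  \<comment> \<open>The slack e provides the strict positivity of the growth constant.\<close>
  have "sqrt (real CARD('n)) \<le> expectation D + e" if "0 < e" for e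
  proof (rule mean_max_growth)
    show "0 < expectation D + e" using \<open>0 \<le> expectation D\<close> that by simp
    show "mean_max k \<le> (expectation D + e) * sqrt (real k)" for k
      using mean_max_le[of k] that by (simp add: distrib_right add_increasing2)
  qed
  then have "sqrt (real CARD('n)) \<le> expectation D"
    by (rule field_le_epsilon)
  with int eq D(4) show ?thesis by simp
qed

end
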